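(* Let $(\Omega,\mathcal{A},T,\mu,\mathcal{F},\|\cdot\|,\chi)$ fulfill Property $\mathfrak{D}$ and let $F(x)=\mu(\chi\le x)$. Let $(f_n)_{n\in\mathbb{N}}$ be a positive valued sequence with $F(f_n)>0$ for all $n\in\mathbb{N}$, and assume that there exists $\psi\in\Psi$ such that $$\frac{f_n}{\int {}^{f_n}\chi\,\mathrm{d}\mu}=o\left(\frac{n}{\log\psi(n)}\right)\qquad(n\to\infty).$$ Then $$\lim_{n\to\infty}\frac{\mathsf{T}_n^{f_n}\chi}{\int\mathsf{T}_n^{f_n}\chi\,\mathrm{d}\mu}=1\quad\mu\text{-almost surely.}$$
   Context: Transfer operator. For a non-singular transformation $T$ of a probability space $(\Omega,\mathcal{A},\mu)$, $\widehat T:\mathcal{L}^1\to\mathcal{L}^1$ is the unique operator with $\int \widehat T f\cdot g\,\mathrm{d}\mu=\int f\cdot g\circ T\,\mathrm{d}\mu$ for all $f\in\mathcal{L}^1$, $g\in\mathcal{L}^\infty$. $|\cdot|_\infty$ is the $\mathcal{L}^\infty$ norm. Spectral gap. A bounded linear operator $U$ on a Banach space has a spectral gap if $U=\lambda P+N$ with $\lambda\in\mathbb{C}$ and $P,N$ bounded linear operators such that $P^2=P$, $\dim \mathrm{Im}(P)=1$, $\rho(N)<|\lambda|$ ($\rho$ = spectral radius), and $PN=NP=0$. Property $\mathfrak{C}$. Let $\mathcal{F}$ be a subset of the measurable functions forming a Banach algebra with respect to a norm $\|\cdot\|$. $(\Omega,\mathcal{A},T,\mu,\mathcal{F},\|\cdot\|)$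 has Property $\mathfrak{C}$ if: $\mu$ is a $T$-invariant, mixing probability measure; $\mathcal{F}$ contains the constant functions and $\|f\|\ge|f|_\infty$ for all $f\in\mathcal{F}$; there is $K_0>0$ with $\|\widehat T f\|\le K_0\|f\|$ for all $f\in\mathcal{F}$; $\widehat T$ has a spectral gap on $\mathcal{F}$ with respect to $\|\cdot\|$. Property $\mathfrak{D}$. Let $\chi:\Omega\to\mathbb{R}_{\ge0}$ be measurable and ${}^{\ell}\chi:=\chi\cdot\mathbb{1}_{\{\chi\le\ell\}}$ for $\ell\ge0$. $(\Omega,\mathcal{A},T,\mu,\mathcal{F},\|\cdot\|,\chi)$ has Property $\mathfrak{D}$ if $(\Omega,\mathcal{A},T,\mu,\mathcal{F},\|\cdot\|)$ has Property $\mathfrak{C}$ and there are $K_1,K_2>0$ such that for all $\ell>0$: $\|{}^{\ell}\chi\|\le K_1\ell$ and $\|\mathbb{1}_{\{\chi>\ell\}}\|\le K_2$. Truncated sums. $\mathsf{T}_n^{f_n}\chi:={}^{f_n}\chi+{}^{f_n}\chi\circ T+\dots+{}^{f_n}\chi\circ T^{n-1}$. $\Psi:=\{u:\mathbb{N}\to\mathbb{R}^+:\ \sum_{n=1}^\infty 1/u(n)<\infty\}$. The $o$-condition is understood to include that the denominator $\int{}^{f_n}\chi\,\mathrm{d}\mu$ is positive for all sufficiently large $n$. *)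

theory Defs
  imports "HOL-Probability.Probability"
begin

text \<open>
  Functions are identified when they agree almost everywhere, as is forced by the fact that the
  transfer operator acts on classes of integrable functions. A space of classes is represented by
  the set of all its representatives, and equality in it is almost everywhere equality. As the eigenvalue
  in a spectral gap may be complex, the scalars and the functions are complex valued.
\<close>

definition Linf_norm :: "'a measure \<Rightarrow> ('a \<Rightarrow> complex) \<Rightarrow> ereal" where
  "Linf_norm M f = esssup M (\<lambda>x. ereal (cmod (f x)))"

text \<open>
  For non-singular \<open>T\<close> the function chosen here exists (Radon-Nikodym) and is unique up to null sets.
\<close>

definition transfer_operator :: "'a measure \<Rightarrow> ('a \<Rightarrow> 'a) \<Rightarrow> ('a \<Rightarrow> complex) \<Rightarrow> ('a \<Rightarrow> complex)" where
  "transfer_operator M T f =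
    (SOME f'. integrable M f' \<and>
       (\<forall>g \<in> borel_measurable M. Linf_norm M g < \<infinity> \<longrightarrow>
          (\<integral>x. f' x * g x \<partial>M) = (\<integral>x. f x * g (T x) \<partial>M)))"

locale function_banach_algebra =
  fixes M :: "'a measure" and \<F> :: "('a \<Rightarrow> complex) set" and nrm :: "('a \<Rightarrow> complex) \<Rightarrow> real"
  assumes measurable: "\<F> \<subseteq> borel_measurable M"
    and AE_closed: "\<And>f g. f \<in> \<F> \<Longrightarrow> g \<in> borel_measurable M \<Longrightarrow> (AE x in M. f x = g x) \<Longrightarrow>
                      g \<in> \<F> \<and> nrm g = nrm f"
    and zero_mem: "(\<lambda>x. 0) \<in> \<F>"
    and add_mem: "\<And>f g. f \<in> \<F> \<Longrightarrow> g \<in> \<F> \<Longrightarrow> (\<lambda>x. f x + g x) \<in> \<F>"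
    and scale_mem: "\<And>c f. f \<in> \<F> \<Longrightarrow> (\<lambda>x. c * f x) \<in> \<F>"
    and mult_mem: "\<And>f g. f \<in> \<F> \<Longrightarrow> g \<in> \<F> \<Longrightarrow> (\<lambda>x. f x * g x) \<in> \<F>"
    and nrm_nonneg: "\<And>f. f \<in> \<F> \<Longrightarrow> 0 \<le> nrm f"
    and nrm_eq_0_iff: "\<And>f. f \<in> \<F> \<Longrightarrow> nrm f = 0 \<longleftrightarrow> (AE x in M. f x = 0)"
    and nrm_add: "\<And>f g. f \<in> \<F> \<Longrightarrow> g \<in> \<F> \<Longrightarrow> nrm (\<lambda>x. f x + g x) \<le> nrm f + nrm g"
    and nrm_scale: "\<And>c f. f \<in> \<F> \<Longrightarrow> nrm (\<lambda>x. c * f x) = cmod c * nrm f"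
    and nrm_mult: "\<And>f g. f \<in> \<F> \<Longrightarrow> g \<in> \<F> \<Longrightarrow> nrm (\<lambda>x. f x * g x) \<le> nrm f * nrm g"
    and complete: "\<And>s :: nat \<Rightarrow> 'a \<Rightarrow> complex. range s \<subseteq> \<F> \<Longrightarrow>
        (\<And>e. e > 0 \<Longrightarrow> \<exists>k. \<forall>m\<ge>k. \<forall>n\<ge>k. nrm (\<lambda>x. s m x - s n x) < e) \<Longrightarrow>
        \<exists>f\<in>\<F>. (\<lambda>n. nrm (\<lambda>x. s n x - f x)) \<longlonglongrightarrow> 0"

text \<open>
  Linearity up to null sets and boundedness together imply compatibility with almost everywhere equality.
\<close>

definition bounded_operator_on ::
    "'a measure \<Rightarrow> ('a \<Rightarrow> complex) set \<Rightarrow> (('a \<Rightarrow> complex) \<Rightarrow> real) \<Rightarrow>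
     (('a \<Rightarrow> complex) \<Rightarrow> ('a \<Rightarrow> complex)) \<Rightarrow> bool" where
  "bounded_operator_on M \<F> nrm U \<longleftrightarrow>
     (\<forall>f\<in>\<F>. U f \<in> \<F>) \<and>
     (\<forall>f\<in>\<F>. \<forall>g\<in>\<F>. AE x in M. U (\<lambda>y. f y + g y) x = U f x + U g x) \<and>
     (\<forall>c. \<forall>f\<in>\<F>. AE x in M. U (\<lambda>y. c * f y) x = c * U f x) \<and>
     (\<exists>C. \<forall>f\<in>\<F>. nrm (U f) \<le> C * nrm f)"

definition spectrum_on ::
    "'a measure \<Rightarrow> ('a \<Rightarrow> complex) set \<Rightarrow> (('a \<Rightarrow> complex) \<Rightarrow> real) \<Rightarrow>
     (('a \<Rightarrow> complex) \<Rightarrow> ('a \<Rightarrow> complex)) \<Rightarrow> complex set" where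
  "spectrum_on M \<F> nrm N =
     {z. \<not> (\<exists>R. bounded_operator_on M \<F> nrm R \<and>
              (\<forall>f\<in>\<F>. AE x in M. R (\<lambda>y. z * f y - N f y) x = f x) \<and>
              (\<forall>f\<in>\<F>. AE x in M. z * R f x - N (R f) x = f x))}"

definition spectral_radius_on ::
    "'a measure \<Rightarrow> ('a \<Rightarrow> complex) set \<Rightarrow> (('a \<Rightarrow> complex) \<Rightarrow> real) \<Rightarrow>
     (('a \<Rightarrow> complex) \<Rightarrow> ('a \<Rightarrow> complex)) \<Rightarrow> ennreal" where
  "spectral_radius_on M \<F> nrm N = (SUP z \<in> spectrum_on M \<F> nrm N. ennreal (cmod z))"

text \<open>The condition on \<open>P ` \<F>\<close> says that the image of \<open>P\<close> is one-dimensional, with basis \<open>h\<close>.\<close>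

definition has_spectral_gap_on ::
    "'a measure \<Rightarrow> ('a \<Rightarrow> complex) set \<Rightarrow> (('a \<Rightarrow> complex) \<Rightarrow> real) \<Rightarrow>
     (('a \<Rightarrow> complex) \<Rightarrow> ('a \<Rightarrow> complex)) \<Rightarrow> bool" where
  "has_spectral_gap_on M \<F> nrm U \<longleftrightarrow>
     bounded_operator_on M \<F> nrm U \<and>
     (\<exists>(ev::complex) P N.
        bounded_operator_on M \<F> nrm P \<and> bounded_operator_on M \<F> nrm N \<and>
        (\<forall>f\<in>\<F>. AE x in M. U f x = ev * P f x + N f x) \<and>
        (\<forall>f\<in>\<F>. AE x in M. P (P f) x = P f x) \<and>
        (\<exists>h \<in> P ` \<F>. \<not> (AE x in M. h x = 0) \<and> (\<forall>g \<in> P ` \<F>. \<exists>c. AE x in M. g x = c * h x)) \<and>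
        spectral_radius_on M \<F> nrm N < ennreal (cmod ev) \<and>
        (\<forall>f\<in>\<F>. AE x in M. P (N f) x = 0) \<and>
        (\<forall>f\<in>\<F>. AE x in M. N (P f) x = 0))"

definition mixing :: "'a measure \<Rightarrow> ('a \<Rightarrow> 'a) \<Rightarrow> bool" where
  "mixing M T \<longleftrightarrow>
     (\<forall>A\<in>sets M. \<forall>B\<in>sets M.
        (\<lambda>n. measure M (A \<inter> ((T ^^ n) -` B \<inter> space M))) \<longlonglongrightarrow> measure M A * measure M B)"

locale property_C = prob_space M + function_banach_algebra M \<F> nrm
  for M :: "'a measure" and T :: "'a \<Rightarrow> 'a"
    and \<F> :: "('a \<Rightarrow> complex) set" and nrm :: "('a \<Rightarrow> complex) \<Rightarrow> real" +
  assumes T_measurable: "T \<in> measurable M M"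
    and invariant: "distr M M T = M"
    and mixing: "mixing M T"
    and const_mem: "\<And>c. (\<lambda>x. c) \<in> \<F>"
    and Linf_norm_le: "\<And>f. f \<in> \<F> \<Longrightarrow> Linf_norm M f \<le> ereal (nrm f)"
    and transfer_bound: "\<exists>K\<^sub>0>0. \<forall>f\<in>\<F>. transfer_operator M T f \<in> \<F> \<and>
                            nrm (transfer_operator M T f) \<le> K\<^sub>0 * nrm f"
    and spectral_gap: "has_spectral_gap_on M \<F> nrm (transfer_operator M T)"

text \<open>\<open>chi\<close> is spelt out because the Greek letter is a binder in \<^theory>\<open>HOL-Analysis.Finite_Cartesian_Product\<close>.\<close>

definition trunc :: "('a \<Rightarrow> real) \<Rightarrow> real \<Rightarrow> 'a \<Rightarrow> real" where
  "trunc chi l x = chi x * indicator {y. chi y \<le> l} x"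

locale property_D = property_C M T \<F> nrm
  for M :: "'a measure" and T :: "'a \<Rightarrow> 'a"
    and \<F> :: "('a \<Rightarrow> complex) set" and nrm :: "('a \<Rightarrow> complex) \<Rightarrow> real" +
  fixes chi :: "'a \<Rightarrow> real"
  assumes chi_measurable: "chi \<in> borel_measurable M"
    and chi_nonneg: "\<And>x. x \<in> space M \<Longrightarrow> 0 \<le> chi x"
    and chi_bounds: "\<exists>K\<^sub>1>0. \<exists>K\<^sub>2>0. \<forall>l>0.
          (\<lambda>x. complex_of_real (trunc chi l x)) \<in> \<F> \<and>
          nrm (\<lambda>x. complex_of_real (trunc chi l x)) \<le> K\<^sub>1 * l \<and>
          (indicator {y. chi y > l} :: 'a \<Rightarrow> complex) \<in> \<F> \<and>
          nrm (indicator {y. chi y > l}) \<le> K\<^sub>2"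

definition trunc_sum :: "('a \<Rightarrow> 'a) \<Rightarrow> ('a \<Rightarrow> real) \<Rightarrow> real \<Rightarrow> nat \<Rightarrow> 'a \<Rightarrow> real" where
  "trunc_sum T chi l n x = (\<Sum>k<n. trunc chi l ((T ^^ k) x))"

text \<open>Sequences are indexed by the positive integers; values at \<open>0\<close> are irrelevant.\<close>

definition Psi :: "(nat \<Rightarrow> real) set" where
  "Psi = {u. (\<forall>n\<ge>1. u n > 0) \<and> summable (\<lambda>n. 1 / u (Suc n))}"

end

theory Submission
  imports Defs
begin

text \<open>
  The spectral gap makes the transfer operator contract exponentially on functions with mean zero.
  Put \<open>\<gamma> = trunc chi l / l\<close>, which takes values in \<open>[0, 1]\<close> and whose norm is bounded uniformly in \<open>l\<close>,
  and let \<open>m\<close> be its integral. Iterating the operator \<open>a \<mapsto> \<tau> ((1 + t \<gamma>) a)\<close> yields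
  \<open>E (\<Prod>i<n. 1 + t \<gamma>(T\<^sup>i x)) \<le> exp (n m (t + D t\<^sup>2))\<close> for small \<open>t\<close> of either sign. The point is that
  the exponent is proportional to \<open>m\<close>, with \<open>D\<close> independent of \<open>l\<close>. Chernoff's method bounds the
  probability of a relative deviation \<open>\<epsilon>\<close> of the truncated sum by \<open>2 exp (- c n m)\<close>, which the
  hypothesis on \<open>f\<close> makes at most \<open>2 / \<psi> n\<close> eventually, and Borel-Cantelli applies.
\<close>

section \<open>Resolvent bounds and the growth of powers\<close>

text \<open>The obstacle is that \<open>m\<close> may tend to 0 along the truncation levels. The
  hypothesis only makes n m / log \<psi>(n) tend to infinity, so a Hoeffding-type bound with an
  exponent of order n m^2 would be too weak: the quadratic term of the exponent has to carry the
  factor \<open>m\<close> as well. It does, because the error is the integral of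
  \<open>\<gamma>\<close> against the mean-zero part of an iterate, and this is at most the sup norm
  of that part times \<open>m\<close>. The factors 1 + t \<open>\<gamma>\<close> stand in for exp (t
  \<open>\<gamma>\<close>): being affine in \<open>\<gamma>\<close>, they are controlled directly by
  the norm of \<open>\<gamma>\<close>, and their second-order deficit is made up for when the
  product is compared with the exponential of the orbit sum. Instead of following the leading
  eigenvalue of a perturbed operator, the mean and the mean-zero part of the iterates are estimated
  jointly by induction, so that the constants depend only on the transfer operator, the norm of 1
  and a bound for the norm of \<open>\<gamma>\<close>.\<close>

lemma smult_sum_right: "smult c (\<Sum>i\<in>S. p i) = (\<Sum>i\<in>S. smult c (p i))"
  by (induction S rule: infinite_finite_induct) (simp_all add: smult_add_right)

text \<open>A discrete Cauchy formula: averaging z^(-j) times the sum over the m-th roots of unity,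
  scaled by \<open>s\<close>, isolates coefficient \<open>j\<close> exactly, because there are only
  \<open>m\<close> coefficients. A finite average asks of \<open>nu\<close> nothing beyond
  subadditivity and the scaling inequality, in particular no continuity.\<close>

lemma cauchy_estimate_roots_of_unity:
  fixes nu :: "complex poly \<Rightarrow> real" and A :: "nat \<Rightarrow> complex poly"
  assumes nu_add: "\<And>p q. nu (p + q) \<le> nu p + nu q"
    and nu_smult: "\<And>c p. nu (smult c p) \<le> cmod c * nu p"
    and s: "s > 0"
    and bound: "\<And>z. cmod z = s \<Longrightarrow> nu (\<Sum>i<m. smult (z ^ i) (A i)) \<le> b"
    and j: "j < m"
  shows "s ^ j * nu (A j) \<le> b"
proof -
  define w where "w = cis (2 * pi / real m)"
  have m: "m > 0" using j by simp
  have "w ^ m = cis (2 * pi)" using m unfolding w_def Complex.DeMoivre by simp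
  hence wm: "w ^ m = 1" by simp
  have w_ne: "w ^ i \<noteq> 1" if "0 < i" "i < m" for i
  proof
    assume "w ^ i = 1"
    hence "cis (2 * pi * real i / real m) = 1" by (simp add: w_def Complex.DeMoivre mult_ac)
    hence "cos (2 * pi * real i / real m) = 1" by (metis cis.sel(1) one_complex.sel(1))
    then obtain k :: int where k: "2 * pi * real i / real m = real_of_int k * 2 * pi"
      using cos_one_2pi_int by auto
    hence "real i = real_of_int k * real m" using m by (simp add: field_simps)
    hence e: "int i = k * int m" by (metis of_int_eq_iff of_int_mult of_int_of_nat_eq)
    with that m have "k > 0" by (metis of_nat_0_less_iff zero_less_mult_pos2)
    hence "k * int m \<ge> 1 * int m" by (intro mult_right_mono) auto
    with e that show False by simp
  qed
  have sum0: "(\<Sum>k<m. (w ^ i) ^ k) = 0" if "w ^ i \<noteq> 1" for i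
  proof -
    have "(w ^ i) ^ m = 1" by (metis power_commutes power_mult power_one wm mult.commute)
    thus ?thesis using geometric_sum[OF that, of m] by simp
  qed
  \<comment> \<open>\<open>w ^ (k * (m - j))\<close> is (w^k)^(-j) written with a natural exponent,
    as w^m = 1.\<close>
  have sums: "(\<Sum>k<m. w ^ (k * (m - j)) * (w ^ k) ^ i) = (if i = j then of_nat m else 0)"
    if i: "i < m" for i
  proof -
    have e: "w ^ (k * (m - j)) * (w ^ k) ^ i = (w ^ (m - j + i)) ^ k" for k
      by (simp add: power_add[symmetric] power_mult[symmetric] algebra_simps)
    have "w ^ (m - j + i) \<noteq> 1" if "i \<noteq> j"
    proof (cases "i < j")
      case True
      then show ?thesis using j by (intro w_ne) auto
    next
      case False
      hence "m - j + i = m + (i - j)" using j by simp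
      hence "w ^ (m - j + i) = w ^ (i - j)" by (simp add: power_add wm)
      then show ?thesis using w_ne[of "i - j"] False that i by auto
    qed
    moreover have "w ^ (m - j + i) = 1" if "i = j" using that j by (simp add: wm)
    ultimately show ?thesis unfolding e using sum0 by auto
  qed
  define c where "c = (1 / of_nat m :: complex)"
  have c: "c * of_nat m = 1" using m by (simp add: c_def)
  define H where "H z = (\<Sum>i<m. smult (z ^ i) (A i))" for z
  have cw: "cmod (w ^ i) = 1" for i by (simp add: w_def norm_power)
  have "(\<Sum>k<m. smult (c * w ^ (k * (m - j))) (H (of_real s * w ^ k)))
      = (\<Sum>i<m. smult (\<Sum>k<m. c * w ^ (k * (m - j)) * (of_real s * w ^ k) ^ i) (A i))"
    unfolding H_def smult_sum_right smult_sum smult_smult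
    by (rule sum.swap)
  also have "\<dots> = (\<Sum>i<m. smult (c * of_real s ^ i * (\<Sum>k<m. w ^ (k * (m - j)) * (w ^ k) ^ i)) (A i))"
    by (intro sum.cong refl arg_cong2[where f = smult])
       (simp add: sum_distrib_left power_mult_distrib mult_ac)
  also have "\<dots> = (\<Sum>i<m. if i = j then smult (c * of_real s ^ j * of_nat m) (A j) else 0)"
    by (intro sum.cong refl) (simp add: sums)
  also have "\<dots> = smult (of_real s ^ j) (A j)"
  proof -
    have "c * of_real s ^ j * of_nat m = of_real s ^ j" using c by (metis mult.commute mult.assoc mult_1)
    thus ?thesis using j by (simp only:) simp
  qed
  finally have eq: "smult (of_real s ^ j) (A j) =
     (\<Sum>k<m. smult (c * w ^ (k * (m - j))) (H (of_real s * w ^ k)))" by simp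
  have nu_sum: "nu (sum g {..<n}) \<le> (\<Sum>k<n. nu (g k))" for g :: "nat \<Rightarrow> complex poly" and n
  proof (induction n)
    case 0
    show ?case using nu_smult[of 0 0] by simp
  next
    case (Suc n)
    then show ?case using nu_add[of "sum g {..<n}" "g n"] by simp
  qed
  have "nu (smult (of_real s ^ j) (A j)) \<le> (\<Sum>k<m. cmod (c * w ^ (k * (m - j))) * b)"
    unfolding eq
    by (rule order_trans[OF nu_sum], intro sum_mono order_trans[OF nu_smult] mult_left_mono)
       (auto simp: H_def norm_mult cw s less_imp_le intro!: bound)
  also have "\<dots> = b" using m by (simp add: norm_mult cw c_def norm_divide)
  finally have 1: "nu (smult (of_real s ^ j) (A j)) \<le> b" .
  \<comment> \<open>The scaling inequality for \<open>nu\<close> goes one way only; applying it to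
    the inverse scalar gives the other direction.\<close>
  have "nu (A j) = nu (smult (1 / of_real s ^ j) (smult (of_real s ^ j) (A j)))"
    using s by simp
  also have "\<dots> \<le> cmod (1 / of_real s ^ j) * nu (smult (of_real s ^ j) (A j))"
    by (rule nu_smult)
  also have "\<dots> = nu (smult (of_real s ^ j) (A j)) / s ^ j"
    using s by (simp add: norm_divide norm_power)
  finally have "s ^ j * nu (A j) \<le> nu (smult (of_real s ^ j) (A j))"
    using s by (simp add: field_simps)
  with 1 show ?thesis by simp
qed

text \<open>
  This replaces the spectral radius formula: \<open>nu p\<close> will be the operator norm of \<open>p\<close> evaluated at an
  operator \<open>N\<close>, and polynomials in \<open>N\<close> make the quotient by almost everywhere equality unnecessary.
  Let \<open>\<rho>\<close> be the growth rate of \<open>nu (X\<^sup>n)\<close> and suppose \<open>\<rho> > r\<close>. Cauchy estimates for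
  \<open>G z = (z\<^sup>n - X\<^sup>n) / (z - X)\<close> show that \<open>nu (X\<^sup>n) / \<rho>\<^sup>n\<close> is bounded, those for \<open>(G z)\<^sup>2\<close>, whose middle
  coefficient is \<open>n X\<^bsup>n-1\<^esup>\<close>, that it tends to \<open>0\<close>. Submultiplicativity then contradicts the choice of \<open>\<rho>\<close>.
\<close>

lemma power_growth_of_resolvent_bounds:
  fixes nu :: "complex poly \<Rightarrow> real"
  assumes nu_nonneg: "\<And>p. 0 \<le> nu p"
    and nu_add: "\<And>p q. nu (p + q) \<le> nu p + nu q"
    and nu_smult: "\<And>c p. nu (smult c p) \<le> cmod c * nu p"
    and nu_mult: "\<And>p q. nu (p * q) \<le> nu p * nu q"
    and res: "\<And>z. r \<le> cmod z \<Longrightarrow> \<exists>B. \<forall>p. nu p \<le> B * nu ([:z, -1:] * p)"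
    and r: "0 < r" "r < s"
  shows "\<exists>C. \<forall>n. nu ([:0, 1:] ^ n) \<le> C * s ^ n"
proof (rule ccontr)
  assume contra: "\<not> ?thesis"
  define X :: "complex poly" where "X = [:0, 1:]"
  define M where "M n = nu (X ^ n)" for n
  \<comment> \<open>The admissible exponential rates. The set is upward closed, and the assumption
    for contradiction keeps \<open>s\<close> out of it, so its infimum \<open>\<rho>\<close>
    satisfies r < s \<le> \<rho>.\<close>
  define S where "S = {s. s > 0 \<and> (\<exists>C. \<forall>n. M n \<le> C * s ^ n)}"
  have M_nonneg: "0 \<le> M n" for n by (simp add: M_def nu_nonneg)
  have M_add: "M (i + j) \<le> M i * M j" for i j
    using nu_mult[of "X ^ i" "X ^ j"] by (simp add: M_def power_add)
  have up: "s' \<in> S" if "s'' \<in> S" "s'' \<le> s'" for s' s''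
  proof -
    from that obtain C where C: "\<And>n. M n \<le> C * s'' ^ n" "s'' > 0" by (auto simp: S_def)
    have "M n \<le> \<bar>C\<bar> * s' ^ n" for n
    proof -
      have "C * s'' ^ n \<le> \<bar>C\<bar> * s' ^ n"
        using C(2) that by (intro mult_mono power_mono) auto
      thus ?thesis using C(1)[of n] by simp
    qed
    thus ?thesis using C(2) that by (auto simp: S_def)
  qed
  \<comment> \<open>One inequality at a single \<open>n\<close> extends to all exponents through
    division with remainder by \<open>n\<close>; the finitely many remainders are absorbed into
    \<open>K\<close>.\<close>
  have in_S: "t \<in> S" if n: "n > 0" and t: "t > 0" and le: "M n \<le> t ^ n" for n t
  proof -
    define K where "K = (\<Sum>i<n. M i / t ^ i)"
    have K: "M i / t ^ i \<le> K" if "i < n" for i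
      unfolding K_def using that t M_nonneg by (intro member_le_sum) auto
    have M_mult: "M (i + k * n) \<le> M i * t ^ (k * n)" for i k
    proof (induction k)
      case 0
      show ?case by simp
    next
      case (Suc k)
      have "M (i + Suc k * n) \<le> M (i + k * n) * M n"
        using M_add[of "i + k * n" n] by (simp add: algebra_simps)
      also have "\<dots> \<le> (M i * t ^ (k * n)) * t ^ n"
        using Suc le M_nonneg t by (intro mult_mono) auto
      finally show ?case by (simp add: power_add mult_ac)
    qed
    have "M k \<le> K * t ^ k" for k
    proof -
      have "M k \<le> M (k mod n) * t ^ (k div n * n)"
        using M_mult[of "k mod n" "k div n"] by (simp add: add.commute)
      also have "\<dots> \<le> (K * t ^ (k mod n)) * t ^ (k div n * n)"
        using K[of "k mod n"] n t by (intro mult_right_mono) (auto simp: field_simps)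
      also have "\<dots> = K * t ^ (k mod n + k div n * n)" by (simp only: power_add mult.assoc)
      finally show ?thesis by (simp only: mod_div_mult_eq)
    qed
    thus ?thesis using t by (auto simp: S_def)
  qed
  have s_notin: "s \<notin> S" using contra r by (auto simp: S_def M_def X_def)
  define \<rho> where "\<rho> = Inf S"
  have "1 + M 1 \<in> S" using in_S[of 1 "1 + M 1"] M_nonneg[of 1] by simp
  hence S_ne: "S \<noteq> {}" by auto
  have S_lower: "s \<le> x" if "x \<in> S" for x using s_notin up[OF that, of s] by linarith
  have bdd: "bdd_below S" using S_lower by (meson bdd_belowI)
  have rho: "s \<le> \<rho>" unfolding \<rho>_def using S_ne S_lower by (rule cInf_greatest)
  have rho_pos: "\<rho> > 0" using rho r by simp
  have above: "x \<in> S" if "x > \<rho>" for x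
    using that up cInf_less_iff[OF S_ne bdd, of x] unfolding \<rho>_def by (auto intro: less_imp_le)
  have below: "x \<notin> S" if "x < \<rho>" for x
    using that cInf_lower[OF _ bdd, of x] unfolding \<rho>_def by auto

  \<comment> \<open>A closed annulus whose inner circle has the critical radius. The estimates are
    needed at radii slightly above \<rho> first, and compactness gives one constant
    \<open>B0\<close> for all of them.\<close>
  define K where "K = cball (0::complex) (\<rho> + 1) - ball 0 \<rho>"
  have "compact K" unfolding K_def by (intro compact_diff) auto
  have "\<exists>B>0. \<forall>p. nu p \<le> B * nu ([:z, -1:] * p)" if "z \<in> K" for z
  proof -
    have "r \<le> cmod z" using that rho r by (auto simp: K_def)
    then obtain B where B: "\<And>p. nu p \<le> B * nu ([:z, -1:] * p)" using res by blast
    have "nu p \<le> (\<bar>B\<bar> + 1) * nu ([:z, -1:] * p)" for p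
      by (rule order_trans[OF B]) (intro mult_right_mono nu_nonneg, simp)
    thus ?thesis by (intro exI[of _ "\<bar>B\<bar> + 1"]) auto
  qed
  then obtain B where B: "\<And>z. z \<in> K \<Longrightarrow> B z > 0"
      "\<And>z p. z \<in> K \<Longrightarrow> nu p \<le> B z * nu ([:z, -1:] * p)"
    by metis
  obtain D where D: "D \<subseteq> K" "finite D" "K \<subseteq> (\<Union>z\<in>D. ball z (1 / (2 * B z)))"
  proof (rule compactE_image[OF \<open>compact K\<close>, of K "\<lambda>z. ball z (1 / (2 * B z))"])
    show "K \<subseteq> (\<Union>z\<in>K. ball z (1 / (2 * B z)))"
    proof
      fix z assume "z \<in> K"
      thus "z \<in> (\<Union>z\<in>K. ball z (1 / (2 * B z)))" using B(1)[of z] by (intro UN_I[of z]) auto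
    qed
  qed (auto intro: that)
  define B0 where "B0 = 1 + (\<Sum>z\<in>D. 2 * B z)"
  have B0_pos: "B0 > 0"
    unfolding B0_def using B(1) D by (intro add_pos_nonneg sum_nonneg) (auto intro: less_imp_le)
  have B0: "nu p \<le> B0 * nu ([:z, -1:] * p)" if zK: "z \<in> K" for z p
  proof -
    obtain z0 where z0: "z0 \<in> D" "dist z0 z < 1 / (2 * B z0)" using subsetD[OF D(3) zK] by auto
    have z0K: "z0 \<in> K" using z0 D by auto
    \<comment> \<open>A Neumann-type perturbation: the bound at \<open>z0\<close> survives on the
      ball of radius \<open>1 / (2 * B z0)\<close>, since half of \<open>nu p\<close> is absorbed on
      the left at the price of doubling the constant.\<close>
    have eq: "[:z0, -1:] * p = [:z, -1:] * p + smult (z0 - z) p"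
      by (simp add: algebra_simps smult_diff_left)
    have "nu p \<le> B z0 * (nu ([:z, -1:] * p) + cmod (z0 - z) * nu p)"
      using B(2)[OF z0K, of p] nu_add[of "[:z, -1:] * p" "smult (z0 - z) p"]
        nu_smult[of "z0 - z" p] B(1)[OF z0K] unfolding eq
      by (smt (verit) mult_left_mono)
    also have "\<dots> \<le> B z0 * (nu ([:z, -1:] * p) + 1 / (2 * B z0) * nu p)"
      using z0(2) B(1)[OF z0K] nu_nonneg
      by (intro mult_left_mono add_left_mono mult_right_mono) (auto simp: dist_norm)
    also have "\<dots> = B z0 * nu ([:z, -1:] * p) + nu p / 2"
      using B(1)[OF z0K] by (simp add: field_simps)
    finally have 1: "nu p \<le> (2 * B z0) * nu ([:z, -1:] * p)" by simp
    have "2 * B z0 \<le> (\<Sum>z\<in>D. 2 * B z)"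
      using z0(1) D B(1) by (intro member_le_sum) (auto intro: less_imp_le)
    hence "2 * B z0 \<le> B0" unfolding B0_def by simp
    with 1 show ?thesis using nu_nonneg by (meson mult_right_mono order_trans)
  qed

  define G where "G n z = (\<Sum>i<n. smult (z ^ i) (X ^ (n - 1 - i)))" for n z
  have G_mult: "[:z, -1:] * G n z = [:z ^ n:] - X ^ n" if "n > 0" for n z
  proof -
    have 1: "[:z ^ n:] = [:z:] ^ n" by (simp add: poly_const_pow)
    have 2: "[:z, -1:] = [:z:] - X" by (simp add: X_def)
    have "[:z:] ^ n - X ^ n = ([:z:] - X) * (\<Sum>i<n. X ^ (n - Suc i) * [:z:] ^ i)"
      by (rule power_diff_sumr2)
    also have "(\<Sum>i<n. X ^ (n - Suc i) * [:z:] ^ i) = G n z"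
      unfolding G_def by (intro sum.cong refl) (simp add: poly_const_pow)
    finally show ?thesis unfolding 1 2 by simp
  qed
  have nu_G: "nu (G n z) \<le> B0 * (M 0 * cmod z ^ n + M n)" if "n > 0" "z \<in> K" for n z
  proof -
    have "[:z ^ n:] - X ^ n = smult (z ^ n) (X ^ 0) + smult (-1) (X ^ n)" by simp
    hence "nu ([:z ^ n:] - X ^ n) \<le> cmod z ^ n * M 0 + M n"
      using nu_add[of "smult (z ^ n) (X ^ 0)" "smult (-1) (X ^ n)"]
        nu_smult[of "z ^ n" "X ^ 0"] nu_smult[of "-1" "X ^ n"]
      by (simp add: M_def norm_power)
    hence "B0 * nu ([:z, -1:] * G n z) \<le> B0 * (M 0 * cmod z ^ n + M n)"
      unfolding G_mult[OF that(1)] using B0_pos by (simp add: mult_ac)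
    thus ?thesis using B0[OF that(2), of "G n z"] by linarith
  qed
  \<comment> \<open>X^k is coefficient n - 1 - k of \<open>G n z\<close>; multiplying its estimate
    by s'^(k + 1) produces the power s'^n on the left.\<close>
  have first: "s' ^ n * M k \<le> B0 * s' ^ Suc k * (M 0 * s' ^ n + M n)"
    if s': "\<rho> \<le> s'" "s' \<le> \<rho> + 1" and "k < n" for s' n k
  proof -
    have "s' ^ (n - 1 - k) * nu (X ^ (n - 1 - (n - 1 - k))) \<le> B0 * (M 0 * s' ^ n + M n)"
    proof (rule cauchy_estimate_roots_of_unity[OF nu_add nu_smult, where m = n])
      show "s' > 0" using s' rho_pos by simp
      show "nu (\<Sum>i<n. smult (z ^ i) (X ^ (n - 1 - i))) \<le> B0 * (M 0 * s' ^ n + M n)"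
        if "cmod z = s'" for z
        using nu_G[of n z] that s' \<open>k < n\<close> by (auto simp: K_def G_def)
    qed (use that in auto)
    hence "s' ^ Suc k * (s' ^ (n - 1 - k) * M k) \<le> s' ^ Suc k * (B0 * (M 0 * s' ^ n + M n))"
      using that rho_pos by (intro mult_left_mono) (auto simp: M_def)
    moreover have "s' ^ Suc k * s' ^ (n - 1 - k) = s' ^ n"
      using that by (simp flip: power_add power_Suc)
    ultimately show ?thesis by (simp only: mult_ac)
  qed
  have second: "\<rho> ^ (n - 1) * (n * M (n - 1)) \<le> (B0 * (M 0 * \<rho> ^ n + M n))\<^sup>2" if n: "n > 0" for n
  proof -
    define a where "a i = (if i < n then X ^ (n - 1 - i) else 0)" for i
    define A where "A i = (\<Sum>k\<le>i. a k * a (i - k))" for i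
    have G_a: "G n z = (\<Sum>i\<le>n - 1. a i * [:z:] ^ i)" for z
      unfolding G_def a_def using n by (intro sum.cong) (auto simp: poly_const_pow)
    have G2: "(\<Sum>i<2 * n - 1. smult (z ^ i) (A i)) = G n z * G n z" for z
    proof -
      have "G n z * G n z = (\<Sum>i\<le>n - 1 + (n - 1). A i * [:z:] ^ i)"
        unfolding A_def G_a by (intro polynomial_product) (auto simp: a_def)
      also have "\<dots> = (\<Sum>i<2 * n - 1. smult (z ^ i) (A i))"
        using n by (intro sum.cong) (auto simp: poly_const_pow)
      finally show ?thesis by simp
    qed
    have est: "\<rho> ^ (n - 1) * nu (A (n - 1)) \<le> (B0 * (M 0 * \<rho> ^ n + M n))\<^sup>2"
    proof (rule cauchy_estimate_roots_of_unity[OF nu_add nu_smult rho_pos, where m = "2 * n - 1"])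
      fix z :: complex assume z: "cmod z = \<rho>"
      hence "nu (G n z) \<le> B0 * (M 0 * \<rho> ^ n + M n)" using nu_G[of n z] n by (auto simp: K_def)
      hence "nu (G n z) * nu (G n z) \<le> (B0 * (M 0 * \<rho> ^ n + M n))\<^sup>2"
        unfolding power2_eq_square by (intro mult_mono) (auto simp: nu_nonneg intro: order_trans[OF nu_nonneg])
      thus "nu (\<Sum>i<2 * n - 1. smult (z ^ i) (A i)) \<le> (B0 * (M 0 * \<rho> ^ n + M n))\<^sup>2"
        unfolding G2 using nu_mult[of "G n z" "G n z"] by linarith
    qed (use n in auto)
    have "A (n - 1) = smult (of_nat n) (X ^ (n - 1))"
    proof -
      \<comment> \<open>Each of the n pairs of indices with sum n - 1 contributes the same power
        X^(n - 1); this is the source of the factor \<open>n\<close>.\<close>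
      have "A (n - 1) = (\<Sum>k\<le>n - 1. X ^ (n - 1))"
        unfolding A_def a_def using n by (intro sum.cong refl) (auto simp flip: power_add)
      thus ?thesis using n by (simp add: of_nat_poly)
    qed
    moreover have "n * M (n - 1) \<le> nu (smult (of_nat n) (X ^ (n - 1)))"
    proof -
      have "M (n - 1) = nu (smult (1 / of_nat n) (smult (of_nat n) (X ^ (n - 1))))"
        using n by (simp add: M_def)
      also have "\<dots> \<le> 1 / n * nu (smult (of_nat n) (X ^ (n - 1)))"
        using nu_smult[of "1 / of_nat n" "smult (of_nat n) (X ^ (n - 1))"] by (simp add: norm_divide)
      finally show ?thesis using n by (simp add: field_simps)
    qed
    ultimately have "n * M (n - 1) \<le> nu (A (n - 1))" by simp
    hence "\<rho> ^ (n - 1) * (n * M (n - 1)) \<le> \<rho> ^ (n - 1) * nu (A (n - 1))"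
      using rho_pos by (intro mult_left_mono) auto
    thus ?thesis using est by linarith
  qed

  \<comment> \<open>For s' strictly above \<rho>, a rate \<open>s1\<close> in between shows that the
    term M n in \<open>first\<close> is o(s'^n), so it drops out as n grows with k fixed. The limit
    of s' towards \<rho> is taken only afterwards.\<close>
  have M_le: "M k \<le> B0 * M 0 * s' ^ Suc k" if s': "\<rho> < s'" "s' \<le> \<rho> + 1" for s' k
  proof -
    define s1 where "s1 = (\<rho> + s') / 2"
    have s1: "\<rho> < s1" "s1 < s'" using s' by (auto simp: s1_def)
    from above[OF s1(1)] obtain C where C: "\<And>n. M n \<le> C * s1 ^ n" by (auto simp: S_def)
    have lim: "(\<lambda>n. B0 * s' ^ Suc k * (M 0 + C * (s1 / s') ^ n)) \<longlonglongrightarrow> B0 * s' ^ Suc k * (M 0 + C * 0)"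
      using s1 rho_pos by (intro tendsto_intros LIMSEQ_realpow_zero) auto
    have "M k \<le> B0 * s' ^ Suc k * (M 0 + C * (s1 / s') ^ n)" if "n > k" for n
    proof -
      have p: "s' > 0" using s' rho_pos by simp
      have "s' ^ n * M k \<le> B0 * s' ^ Suc k * (M 0 * s' ^ n + M n)" using first[of s' k n] s' that by simp
      also have "\<dots> \<le> B0 * s' ^ Suc k * (M 0 * s' ^ n + C * s1 ^ n)"
        using C[of n] B0_pos p by (intro mult_left_mono add_left_mono) auto
      also have "\<dots> = s' ^ n * (B0 * s' ^ Suc k * (M 0 + C * (s1 / s') ^ n))"
        using p by (simp add: field_simps)
      finally show ?thesis using p by simp
    qed
    hence "M k \<le> B0 * s' ^ Suc k * (M 0 + C * 0)"
      by (intro LIMSEQ_le_const[OF lim]) (auto intro!: exI[of _ "Suc k"])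
    thus ?thesis by (simp add: mult_ac)
  qed
  have M_rho: "M k \<le> B0 * M 0 * \<rho> ^ Suc k" for k
  proof (rule tendsto_lowerbound)
    show "((\<lambda>x. B0 * M 0 * x ^ Suc k) \<longlongrightarrow> B0 * M 0 * \<rho> ^ Suc k) (at_right \<rho>)"
      by (intro tendsto_intros)
    have "eventually (\<lambda>x. x \<in> {\<rho><..<\<rho> + 1}) (at_right \<rho>)"
      by (rule eventually_at_right_real) simp
    thus "eventually (\<lambda>x. M k \<le> B0 * M 0 * x ^ Suc k) (at_right \<rho>)"
      by eventually_elim (use M_le in auto)
  qed simp
  \<comment> \<open>Bounding M (n + 1) in \<open>second\<close> through \<open>M_rho\<close> and
    cancelling \<rho>^n leaves a bound of order \<rho>^n, with the factor n + 1 on the left as the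
    gain.\<close>
  define E where "E = (B0 * (M 0 + B0 * M 0 * \<rho>))\<^sup>2 * \<rho>\<^sup>2"
  have E: "real (Suc n) * M n \<le> E * \<rho> ^ n" for n
  proof -
    have "\<rho> ^ n * (Suc n * M n) \<le> (B0 * (M 0 * \<rho> ^ Suc n + M (Suc n)))\<^sup>2"
      using second[of "Suc n"] by simp
    also have "\<dots> \<le> (B0 * (M 0 * \<rho> ^ Suc n + B0 * M 0 * \<rho> ^ Suc (Suc n)))\<^sup>2"
      using B0_pos rho_pos M_nonneg
      by (intro power_mono mult_left_mono add_left_mono M_rho) (auto intro!: mult_nonneg_nonneg add_nonneg_nonneg)
    also have "\<dots> = \<rho> ^ n * (E * \<rho> ^ n)"
      by (simp add: E_def power2_eq_square algebra_simps)
    finally show ?thesis using rho_pos by simp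
  qed
  obtain n :: nat where n: "real n > 2 * \<bar>E\<bar> + 1" using reals_Archimedean2 by blast
  hence n_pos: "n > 0" by (cases n) auto
  have "real n * M n \<le> \<bar>E\<bar> * \<rho> ^ n"
  proof -
    have "real n * M n \<le> real (Suc n) * M n" using M_nonneg by (intro mult_right_mono) auto
    also note E
    also have "E * \<rho> ^ n \<le> \<bar>E\<bar> * \<rho> ^ n" using rho_pos by (intro mult_right_mono) auto
    finally show ?thesis .
  qed
  also have "\<dots> \<le> real n * (\<rho> ^ n / 2)" using n rho_pos by (simp add: field_simps)
  finally have Mn: "M n \<le> \<rho> ^ n / 2" using n_pos by simp
  \<comment> \<open>As M n is at most half of \<rho>^n, continuity leaves room for some x < \<rho>
    with M n \<le> x^n, and \<open>in_S\<close> puts this x into \<open>S\<close>, below its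
    infimum.\<close>
  have lim: "((\<lambda>x. x ^ n) \<longlongrightarrow> \<rho> ^ n) (at_left \<rho>)" by (intro tendsto_intros)
  have "eventually (\<lambda>x. x ^ n > \<rho> ^ n / 2) (at_left \<rho>)"
    using rho_pos by (intro order_tendstoD(1)[OF lim]) simp
  moreover have "eventually (\<lambda>x. x \<in> {0<..<\<rho>}) (at_left \<rho>)"
    using rho_pos by (rule eventually_at_left_real)
  ultimately have "eventually (\<lambda>x. 0 < x \<and> x < \<rho> \<and> M n \<le> x ^ n) (at_left \<rho>)"
    by eventually_elim (use Mn in auto)
  then obtain x where "0 < x" "x < \<rho>" "M n \<le> x ^ n"
    by (metis (mono_tags, lifting) eventually_happens trivial_limit_at_left_real)
  with in_S[OF n_pos] below show False by auto
qed

section \<open>Bounded operators modulo null sets, their norms and polynomials in them\<close>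

context function_banach_algebra
begin

lemma diff_mem: "f \<in> \<F> \<Longrightarrow> g \<in> \<F> \<Longrightarrow> (\<lambda>x. f x - g x) \<in> \<F>"
  using add_mem[of f "\<lambda>x. -1 * g x"] scale_mem[of g "-1"] by simp

lemma nrm_zero: "nrm (\<lambda>x. 0) = 0"
  using nrm_eq_0_iff[OF zero_mem] by simp

lemma nrm_minus: "f \<in> \<F> \<Longrightarrow> nrm (\<lambda>x. - f x) = nrm f"
  using nrm_scale[of f "-1"] by simp

lemma nrm_diff: "f \<in> \<F> \<Longrightarrow> g \<in> \<F> \<Longrightarrow> nrm (\<lambda>x. f x - g x) \<le> nrm f + nrm g"
  using nrm_add[of f "\<lambda>x. - g x"] scale_mem[of g "-1"] nrm_minus[of g] by simp

lemma nrm_cong_AE: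
  "f \<in> \<F> \<Longrightarrow> g \<in> \<F> \<Longrightarrow> (AE x in M. f x = g x) \<Longrightarrow> nrm f = nrm g"
  using AE_closed measurable by (metis subsetD)

lemma bounded_operator_mem: "bounded_operator_on M \<F> nrm U \<Longrightarrow> f \<in> \<F> \<Longrightarrow> U f \<in> \<F>"
  by (simp add: bounded_operator_on_def)

lemma bounded_operator_add:
  "bounded_operator_on M \<F> nrm U \<Longrightarrow> f \<in> \<F> \<Longrightarrow> g \<in> \<F> \<Longrightarrow>
    AE x in M. U (\<lambda>y. f y + g y) x = U f x + U g x"
  by (simp add: bounded_operator_on_def)

lemma bounded_operator_scale:
  "bounded_operator_on M \<F> nrm U \<Longrightarrow> f \<in> \<F> \<Longrightarrow> AE x in M. U (\<lambda>y. c * f y) x = c * U f x"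
  by (simp add: bounded_operator_on_def)

text \<open>The difference of \<open>f\<close> and \<open>g\<close> has norm 0, boundedness gives
  its image norm 0, and so this image vanishes almost everywhere.\<close>

lemma bounded_operator_cong_AE:
  assumes U: "bounded_operator_on M \<F> nrm U" and fg: "f \<in> \<F>" "g \<in> \<F>" "AE x in M. f x = g x"
  shows "AE x in M. U f x = U g x"
proof -
  let ?d = "\<lambda>x. f x + (-1) * g x"
  have d: "?d \<in> \<F>" by (rule add_mem[OF fg(1) scale_mem[OF fg(2)]])
  have "nrm ?d = 0" using fg(3) by (subst nrm_eq_0_iff[OF d]) (auto elim: eventually_mono)
  moreover obtain C where "nrm (U ?d) \<le> C * nrm ?d" and Ud: "U ?d \<in> \<F>"
    using U d unfolding bounded_operator_on_def by blast
  ultimately have "nrm (U ?d) = 0" using nrm_nonneg[OF Ud] by simp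
  hence "AE x in M. U ?d x = 0" using nrm_eq_0_iff[OF Ud] by simp
  moreover have "AE x in M. U ?d x = U f x + U (\<lambda>x. (-1) * g x) x"
    by (rule bounded_operator_add[OF U fg(1) scale_mem[OF fg(2)]])
  moreover have "AE x in M. U (\<lambda>x. (-1) * g x) x = (-1) * U g x"
    by (rule bounded_operator_scale[OF U fg(2)])
  ultimately show ?thesis by eventually_elim simp
qed

lemma bounded_operator_diff:
  assumes U: "bounded_operator_on M \<F> nrm U" and fg: "f \<in> \<F>" "g \<in> \<F>"
  shows "AE x in M. U (\<lambda>y. f y - g y) x = U f x - U g x"
  using bounded_operator_add[OF U fg(1) scale_mem[OF fg(2), of "-1"]]
    bounded_operator_scale[OF U fg(2), of "-1"]
  by eventually_elim simp

lemma bounded_operator_bound: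
  assumes "bounded_operator_on M \<F> nrm U"
  obtains C where "C > 0" "\<And>f. f \<in> \<F> \<Longrightarrow> nrm (U f) \<le> C * nrm f"
proof -
  obtain C where C: "\<And>f. f \<in> \<F> \<Longrightarrow> nrm (U f) \<le> C * nrm f"
    using assms unfolding bounded_operator_on_def by blast
  have "nrm (U f) \<le> (\<bar>C\<bar> + 1) * nrm f" if "f \<in> \<F>" for f
    by (rule order_trans[OF C[OF that] mult_right_mono]) (use nrm_nonneg[OF that] in auto)
  thus thesis by (intro that[of "\<bar>C\<bar> + 1"]) auto
qed

lemma bounded_operator_zero: "bounded_operator_on M \<F> nrm (\<lambda>f x. 0)"
  by (auto simp: bounded_operator_on_def zero_mem nrm_zero intro!: exI[of _ 0])

text \<open>This is the Horner step: with \<open>V\<close> = N and \<open>U\<close> = p(N) it covers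
  the evaluation of \<open>pCons a p\<close> at N, so induction on the polynomial makes every
  \<open>peval N p\<close> bounded.\<close>

lemma bounded_operator_scale_plus_comp:
  assumes U: "bounded_operator_on M \<F> nrm U" and V: "bounded_operator_on M \<F> nrm V"
  shows "bounded_operator_on M \<F> nrm (\<lambda>f x. a * f x + U (V f) x)"
proof -
  note mem = bounded_operator_mem[OF U] bounded_operator_mem[OF V]
  obtain C where C: "C > 0" "\<And>f. f \<in> \<F> \<Longrightarrow> nrm (U f) \<le> C * nrm f"
    using bounded_operator_bound[OF U] by blast
  obtain D where D: "D > 0" "\<And>f. f \<in> \<F> \<Longrightarrow> nrm (V f) \<le> D * nrm f"
    using bounded_operator_bound[OF V] by blast
  have "nrm (\<lambda>x. a * f x + U (V f) x) \<le> (cmod a + C * D) * nrm f" if f: "f \<in> \<F>" for f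
  proof -
    have "nrm (U (V f)) \<le> C * (D * nrm f)"
      using C(2)[OF mem(2)[OF f]] D(2)[OF f] C(1) by (meson mult_left_mono less_imp_le order_trans)
    thus ?thesis
      using nrm_add[OF scale_mem[OF f, of a] mem(1)[OF mem(2)[OF f]]] nrm_scale[OF f, of a]
      by (simp add: algebra_simps)
  qed
  moreover have "AE x in M. a * (f x + g x) + U (V (\<lambda>y. f y + g y)) x
      = (a * f x + U (V f) x) + (a * g x + U (V g) x)" if f: "f \<in> \<F>" and g: "g \<in> \<F>" for f g
  proof -
    have "AE x in M. U (V (\<lambda>y. f y + g y)) x = U (\<lambda>x. V f x + V g x) x"
      by (intro bounded_operator_cong_AE[OF U _ _ bounded_operator_add[OF V f g]] add_mem mem f g)
    with bounded_operator_add[OF U mem(2)[OF f] mem(2)[OF g]] show ?thesis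
      by eventually_elim (simp add: algebra_simps)
  qed
  moreover have "AE x in M. a * (c * f x) + U (V (\<lambda>y. c * f y)) x = c * (a * f x + U (V f) x)"
    if f: "f \<in> \<F>" for f c
  proof -
    have "AE x in M. U (V (\<lambda>y. c * f y)) x = U (\<lambda>x. c * V f x) x"
      by (intro bounded_operator_cong_AE[OF U _ _ bounded_operator_scale[OF V f]] scale_mem mem f)
    with bounded_operator_scale[OF U mem(2)[OF f], of c] show ?thesis
      by eventually_elim (simp add: algebra_simps)
  qed
  moreover have "(\<lambda>x. a * f x + U (V f) x) \<in> \<F>" if "f \<in> \<F>" for f
    by (intro add_mem scale_mem mem that)
  ultimately show ?thesis
    unfolding bounded_operator_on_def by (intro conjI ballI allI exI[of _ "cmod a + C * D"]) auto
qed

text \<open>An infimum of admissible constants avoids quotients by \<open>nrm f\<close>, which may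
  be 0. The clause \<open>0 \<le> c\<close> keeps the set bounded below even if every
  \<open>f\<close> in the space has norm 0.\<close>

definition opnorm :: "(('a \<Rightarrow> complex) \<Rightarrow> ('a \<Rightarrow> complex)) \<Rightarrow> real" where
  "opnorm U = Inf {c. 0 \<le> c \<and> (\<forall>f\<in>\<F>. nrm (U f) \<le> c * nrm f)}"

lemma opnorm_le: "0 \<le> c \<Longrightarrow> (\<And>f. f \<in> \<F> \<Longrightarrow> nrm (U f) \<le> c * nrm f) \<Longrightarrow> opnorm U \<le> c"
  unfolding opnorm_def by (rule cInf_lower) (auto intro: bdd_belowI[of _ 0])

lemma
  assumes U: "bounded_operator_on M \<F> nrm U"
  shows opnorm_nonneg: "0 \<le> opnorm U"
    and opnorm_bound: "f \<in> \<F> \<Longrightarrow> nrm (U f) \<le> opnorm U * nrm f"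
proof -
  define S where "S = {c. 0 \<le> c \<and> (\<forall>f\<in>\<F>. nrm (U f) \<le> c * nrm f)}"
  obtain C where "C > 0" "\<And>f. f \<in> \<F> \<Longrightarrow> nrm (U f) \<le> C * nrm f"
    using bounded_operator_bound[OF U] by blast
  hence C: "C \<in> S" by (simp add: S_def)
  hence ne: "S \<noteq> {}" by blast
  have op: "opnorm U = Inf S" by (simp add: opnorm_def S_def)
  show "0 \<le> opnorm U"
    unfolding op by (rule cInf_greatest[OF ne]) (simp add: S_def)
  assume f: "f \<in> \<F>"
  show "nrm (U f) \<le> opnorm U * nrm f"
  proof (cases "nrm f = 0")
    case True
    moreover have "nrm (U f) \<le> C * nrm f" using C f by (simp add: S_def)
    ultimately show ?thesis by simp
  next
    case False
    hence pos: "nrm f > 0" using nrm_nonneg[OF f] by simp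
    have "nrm (U f) / nrm f \<le> opnorm U"
      unfolding op using f pos by (intro cInf_greatest[OF ne]) (simp add: S_def divide_le_eq)
    thus ?thesis using pos by (simp add: divide_le_eq)
  qed
qed

text \<open>Terms are combined pointwise on representatives, so the laws for sums and scalar
  multiples of polynomials are genuine equalities of functions. Only the product law has to be read
  modulo null sets, because it uses the linearity of N.\<close>

definition peval ::
    "(('a \<Rightarrow> complex) \<Rightarrow> ('a \<Rightarrow> complex)) \<Rightarrow> complex poly \<Rightarrow> ('a \<Rightarrow> complex) \<Rightarrow> ('a \<Rightarrow> complex)" where
  "peval N p f x = (\<Sum>i\<le>degree p. coeff p i * (N ^^ i) f x)"

lemma peval_eq_sum: "degree p \<le> d \<Longrightarrow> peval N p f x = (\<Sum>i\<le>d. coeff p i * (N ^^ i) f x)"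
  unfolding peval_def by (rule sum.mono_neutral_left) (auto simp: coeff_eq_0)

lemma peval_zero: "peval N 0 f = (\<lambda>x. 0)"
  by (simp add: peval_def fun_eq_iff)

lemma peval_pCons: "peval N (pCons a p) f = (\<lambda>x. a * f x + peval N p (N f) x)"
proof
  fix x
  have "peval N (pCons a p) f x = (\<Sum>i\<le>Suc (degree p). coeff (pCons a p) i * (N ^^ i) f x)"
    by (rule peval_eq_sum) (rule degree_pCons_le)
  also have "\<dots> = a * f x + peval N p (N f) x"
    unfolding sum.atMost_Suc_shift peval_def by (simp add: funpow_swap1)
  finally show "peval N (pCons a p) f x = a * f x + peval N p (N f) x" .
qed

lemma peval_add: "peval N (p + q) f = (\<lambda>x. peval N p f x + peval N q f x)"
proof
  fix x
  let ?d = "max (degree p) (degree q)"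
  show "peval N (p + q) f x = peval N p f x + peval N q f x"
    using peval_eq_sum[of "p + q" ?d N f x] peval_eq_sum[of p ?d N f x] peval_eq_sum[of q ?d N f x]
    by (simp add: degree_add_le_max sum.distrib algebra_simps)
qed

lemma peval_smult: "peval N (smult c p) f = (\<lambda>x. c * peval N p f x)"
proof
  fix x
  show "peval N (smult c p) f x = c * peval N p f x"
    using peval_eq_sum[of "smult c p" "degree p" N f x]
    by (simp add: peval_def sum_distrib_left mult.assoc)
qed

lemma peval_X_power: "peval N ([:0, 1:] ^ n) f = (N ^^ n) f"
proof (induction n arbitrary: f)
  case 0
  show ?case by (simp add: one_pCons peval_pCons peval_zero fun_eq_iff)
next
  case (Suc n)
  have "[:0, 1:] ^ Suc n = pCons (0 :: complex) ([:0, 1:] ^ n)" by simp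
  thus ?case by (simp add: peval_pCons Suc funpow_swap1)
qed

lemma bounded_operator_peval:
  assumes N: "bounded_operator_on M \<F> nrm N"
  shows "bounded_operator_on M \<F> nrm (peval N p)"
proof (induction p rule: pCons_induct)
  case 0
  have "peval N 0 = (\<lambda>f x. 0)" by (intro ext) (simp add: peval_zero)
  then show ?case using bounded_operator_zero by metis
next
  case (pCons a p)
  have "peval N (pCons a p) = (\<lambda>f x. a * f x + peval N p (N f) x)" by (intro ext) (simp add: peval_pCons)
  then show ?case using bounded_operator_scale_plus_comp[OF pCons(2) N] by metis
qed

lemma peval_mult:
  assumes N: "bounded_operator_on M \<F> nrm N" and f: "f \<in> \<F>"
  shows "AE x in M. peval N (p * q) f x = peval N p (peval N q f) x"
  using f
proof (induction q arbitrary: f rule: pCons_induct)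
  case 0
  have "AE x in M. peval N p (\<lambda>x. 0 * f x) x = 0 * peval N p f x"
    by (rule bounded_operator_scale[OF bounded_operator_peval[OF N] 0])
  then show ?case by (simp add: peval_zero)
next
  case (pCons a q)
  note mem = bounded_operator_mem[OF N pCons(3)]
    bounded_operator_mem[OF bounded_operator_peval[OF N]]
  have "p * pCons a q = smult a p + pCons 0 (p * q)" by simp
  hence eq: "peval N (p * pCons a q) f = (\<lambda>x. a * peval N p f x + peval N (p * q) (N f) x)"
    by (simp only: peval_add peval_smult peval_pCons) simp
  have "AE x in M. peval N (p * q) (N f) x = peval N p (peval N q (N f)) x"
    using pCons(2)[OF mem(1)] .
  moreover have "AE x in M. peval N p (\<lambda>x. a * f x + peval N q (N f) x) x =
      peval N p (\<lambda>x. a * f x) x + peval N p (peval N q (N f)) x"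
    using pCons(3) mem by (intro bounded_operator_add[OF bounded_operator_peval[OF N]] scale_mem) auto
  moreover have "AE x in M. peval N p (\<lambda>x. a * f x) x = a * peval N p f x"
    using pCons(3) by (intro bounded_operator_scale[OF bounded_operator_peval[OF N]])
  ultimately show ?case unfolding eq peval_pCons by eventually_elim simp
qed

text \<open>Beyond the spectral radius each z has a bounded resolvent, and applying it to (z - N)
  p(N) f gives the hypothesis of \<open>power_growth_of_resolvent_bounds\<close> for the operator
  norm of p(N). The gap below \<open>R\<close> is divided by \<open>r\<close>, for the resolvents,
  and \<open>s\<close>, for the growth.\<close>

lemma funpow_bound_of_spectral_radius:
  assumes N: "bounded_operator_on M \<F> nrm N"
    and radius: "spectral_radius_on M \<F> nrm N < ennreal R"
  obtains C s where "C > 0" "0 < s" "s < R" "\<And>f n. f \<in> \<F> \<Longrightarrow> nrm ((N ^^ n) f) \<le> C * s ^ n * nrm f"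
proof -
  \<comment> \<open>Being strictly above the spectral radius makes this intermediate value positive
    even if the spectral radius is 0, as the growth lemma demands.\<close>
  obtain r' where r': "spectral_radius_on M \<F> nrm N < r'" "r' < ennreal R" using dense[OF radius] by blast
  define r where "r = enn2real r'"
  have r'_fin: "r' < top" using r'(2) by (meson ennreal_less_top order.strict_trans)
  have r'_eq: "r' = ennreal r" by (simp add: r_def r'_fin)
  have "0 < r'" using r'(1) by (metis gr_zeroI not_less_zero)
  hence r_pos: "0 < r" by (simp add: r_def enn2real_positive_iff r'_fin)
  have rR: "r < R" using r'(2) r_pos unfolding r'_eq by (subst (asm) ennreal_less_iff) auto
  define s where "s = (r + R) / 2"
  have s: "r < s" "s < R" using rR by (auto simp: s_def)
  note bp = bounded_operator_peval[OF N]
  note mem = bounded_operator_mem[OF bp]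
  have "\<exists>C. \<forall>n. opnorm (peval N ([:0, 1:] ^ n)) \<le> C * s ^ n"
  proof (rule power_growth_of_resolvent_bounds[where nu = "\<lambda>p. opnorm (peval N p)", OF _ _ _ _ _ r_pos s(1)])
    show "0 \<le> opnorm (peval N p)" for p by (rule opnorm_nonneg[OF bp])
    show "opnorm (peval N (p + q)) \<le> opnorm (peval N p) + opnorm (peval N q)" for p q
    proof (rule opnorm_le)
      fix f assume f: "f \<in> \<F>"
      show "nrm (peval N (p + q) f) \<le> (opnorm (peval N p) + opnorm (peval N q)) * nrm f"
        unfolding peval_add
        using nrm_add[OF mem[OF f, of p] mem[OF f, of q]] opnorm_bound[OF bp f, of p] opnorm_bound[OF bp f, of q]
        by (simp add: algebra_simps)
    qed (simp add: opnorm_nonneg bp)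
    show "opnorm (peval N (smult c p)) \<le> cmod c * opnorm (peval N p)" for c p
    proof (rule opnorm_le)
      fix f assume f: "f \<in> \<F>"
      show "nrm (peval N (smult c p) f) \<le> cmod c * opnorm (peval N p) * nrm f"
        unfolding peval_smult nrm_scale[OF mem[OF f]]
        using opnorm_bound[OF bp f, of p] by (simp add: mult_left_mono mult.assoc)
    qed (simp add: opnorm_nonneg bp)
    show "opnorm (peval N (p * q)) \<le> opnorm (peval N p) * opnorm (peval N q)" for p q
    proof (rule opnorm_le)
      fix f assume f: "f \<in> \<F>"
      have "nrm (peval N (p * q) f) = nrm (peval N p (peval N q f))"
        by (intro nrm_cong_AE peval_mult[OF N f] mem f)
      also have "\<dots> \<le> opnorm (peval N p) * (opnorm (peval N q) * nrm f)"
        using opnorm_bound[OF bp mem[OF f], of p q] opnorm_bound[OF bp f, of q] opnorm_nonneg[OF bp, of p]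
        by (meson mult_left_mono order_trans)
      finally show "nrm (peval N (p * q) f) \<le> opnorm (peval N p) * opnorm (peval N q) * nrm f"
        by (simp add: mult.assoc)
    qed (simp add: opnorm_nonneg bp)
    fix z :: complex assume z: "r \<le> cmod z"
    have "z \<notin> spectrum_on M \<F> nrm N"
    proof
      assume "z \<in> spectrum_on M \<F> nrm N"
      hence "ennreal (cmod z) \<le> spectral_radius_on M \<F> nrm N"
        unfolding spectral_radius_on_def by (rule SUP_upper)
      also note r'(1)
      finally show False using z r_pos by (simp add: r'_eq ennreal_less_iff)
    qed
    then obtain R where R: "bounded_operator_on M \<F> nrm R"
        "\<And>f. f \<in> \<F> \<Longrightarrow> AE x in M. R (\<lambda>y. z * f y - N f y) x = f x"
      unfolding spectrum_on_def by blast
    obtain B where B: "B > 0" "\<And>f. f \<in> \<F> \<Longrightarrow> nrm (R f) \<le> B * nrm f"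
      using bounded_operator_bound[OF R(1)] by blast
    have "opnorm (peval N p) \<le> B * opnorm (peval N ([:z, -1:] * p))" for p
    proof (rule opnorm_le)
      fix f assume f: "f \<in> \<F>"
      let ?h = "peval N p f"
      have h: "?h \<in> \<F>" "N ?h \<in> \<F>" using mem[OF f] bounded_operator_mem[OF N] by auto
      let ?g = "\<lambda>y. z * ?h y - N ?h y"
      have g: "?g \<in> \<F>" by (intro diff_mem scale_mem h)
      have "AE x in M. peval N ([:z, -1:] * p) f x = ?g x"
        using peval_mult[OF N f, of "[:z, -1:]" p] by (simp only: peval_pCons peval_zero) simp
      hence 1: "nrm (peval N ([:z, -1:] * p) f) = nrm ?g" by (intro nrm_cong_AE mem f g)
      have "nrm ?h = nrm (R ?g)"
        using R(2)[OF h(1)] by (intro nrm_cong_AE h bounded_operator_mem[OF R(1)] g) (auto elim: eventually_mono)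
      also have "\<dots> \<le> B * nrm ?g" by (rule B(2)[OF g])
      also have "\<dots> \<le> B * (opnorm (peval N ([:z, -1:] * p)) * nrm f)"
        unfolding 1[symmetric] using opnorm_bound[OF bp f] B(1) by (intro mult_left_mono) auto
      finally show "nrm ?h \<le> B * opnorm (peval N ([:z, -1:] * p)) * nrm f" by (simp add: mult.assoc)
    qed (use B(1) in \<open>simp add: opnorm_nonneg bp\<close>)
    thus "\<exists>B. \<forall>p. opnorm (peval N p) \<le> B * opnorm (peval N ([:z, -1:] * p))" by blast
  qed
  then obtain C where C: "\<And>n. opnorm (peval N ([:0, 1:] ^ n)) \<le> C * s ^ n" by blast
  show thesis
  proof (rule that[of "\<bar>C\<bar> + 1" s])
    fix f :: "'a \<Rightarrow> complex" and n assume f: "f \<in> \<F>"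
    have "nrm ((N ^^ n) f) \<le> opnorm (peval N ([:0, 1:] ^ n)) * nrm f"
      using opnorm_bound[OF bp f, of "[:0, 1:] ^ n"] by (simp add: peval_X_power)
    also have "\<dots> \<le> ((\<bar>C\<bar> + 1) * s ^ n) * nrm f"
      by (intro mult_right_mono nrm_nonneg[OF f] order_trans[OF C])
         (use s r_pos in auto)
    finally show "nrm ((N ^^ n) f) \<le> (\<bar>C\<bar> + 1) * s ^ n * nrm f" .
  qed (use s r_pos in auto)
qed

end

section \<open>The transfer operator on functions with mean zero\<close>

lemma Linf_norm_finiteD:
  assumes "Linf_norm M g < \<infinity>"
  obtains c where "AE x in M. cmod (g x) \<le> c"
proof -
  have 1: "AE x in M. ereal (cmod (g x)) \<le> Linf_norm M g"
    unfolding Linf_norm_def by (rule esssup_AE)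
  have "AE x in M. cmod (g x) \<le> real_of_ereal (Linf_norm M g)"
    using 1
  proof eventually_elim
    case (elim x)
    then show ?case using assms by (cases "Linf_norm M g") auto
  qed
  thus thesis by (rule that)
qed

lemma Linf_norm_finiteI:
  assumes "g \<in> borel_measurable M" "AE x in M. cmod (g x) \<le> c"
  shows "Linf_norm M g < \<infinity>"
proof -
  have "Linf_norm M g \<le> ereal c"
    unfolding Linf_norm_def using assms by (intro esssup_I) auto
  thus ?thesis by (rule order.strict_trans1) simp
qed

lemma integrable_mult_AE_bounded:
  fixes h g :: "'a \<Rightarrow> complex"
  assumes "integrable M h" "g \<in> borel_measurable M" "AE x in M. cmod (g x) \<le> c"
  shows "integrable M (\<lambda>x. h x * g x)"
proof (rule Bochner_Integration.integrable_bound)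
  show "integrable M (\<lambda>x. c * cmod (h x))" using assms(1) by auto
  show "AE x in M. norm (h x * g x) \<le> norm (c * cmod (h x))"
    using assms(3)
  proof eventually_elim
    case (elim x)
    have "norm (h x * g x) \<le> c * cmod (h x)"
      using elim by (simp add: norm_mult mult.commute mult_right_mono)
    thus ?case by simp
  qed
qed (use assms in auto)

lemma mult_cnj_sgn: "z * cnj (sgn z) = of_real (cmod z)"
proof (cases "z = 0")
  case False
  have "z * cnj (sgn z) = of_real (cmod z ^ 2) / of_real (cmod z)"
    unfolding sgn_eq complex_norm_square by simp
  thus ?thesis using False by (simp add: power2_eq_square)
qed simp

lemma borel_measurable_cnj_sgn:
  assumes [measurable]: "f \<in> borel_measurable M"
  shows "(\<lambda>x. cnj (sgn (f x))) \<in> borel_measurable M"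
proof -
  have [measurable]: "cnj \<in> borel_measurable borel"
    by (intro borel_measurable_continuous_onI continuous_intros)
  show ?thesis unfolding sgn_div_norm by measurable
qed

text \<open>Testing with the conjugate sign of the difference turns equality of the pairings into
  vanishing of the L1 norm of the difference.\<close>

lemma AE_eq_of_integral_mult_eq:
  fixes h1 h2 :: "'a \<Rightarrow> complex"
  assumes int: "integrable M h1" "integrable M h2"
    and eq: "\<And>g. g \<in> borel_measurable M \<Longrightarrow> Linf_norm M g < \<infinity> \<Longrightarrow>
      (\<integral>x. h1 x * g x \<partial>M) = (\<integral>x. h2 x * g x \<partial>M)"
  shows "AE x in M. h1 x = h2 x"
proof -
  define d where "d x = h1 x - h2 x" for x
  define g where "g x = cnj (sgn (d x))" for x
  have d: "integrable M d" unfolding d_def using int by auto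
  have g_meas: "g \<in> borel_measurable M"
    unfolding g_def using d by (intro borel_measurable_cnj_sgn) auto
  have g_bound: "AE x in M. cmod (g x) \<le> 1" by (simp add: g_def norm_sgn)
  have "(\<integral>x. cmod (d x) \<partial>M) = 0"
  proof -
    have "complex_of_real (\<integral>x. cmod (d x) \<partial>M) = (\<integral>x. d x * g x \<partial>M)"
      by (simp add: g_def mult_cnj_sgn)
    also have "\<dots> = (\<integral>x. h1 x * g x \<partial>M) - (\<integral>x. h2 x * g x \<partial>M)"
      unfolding d_def left_diff_distrib
      by (intro Bochner_Integration.integral_diff integrable_mult_AE_bounded[OF _ g_meas g_bound] int)
    also have "\<dots> = 0" using eq[OF g_meas Linf_norm_finiteI[OF g_meas g_bound]] by simp
    finally show ?thesis by simp
  qed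
  hence "AE x in M. cmod (d x) = 0"
    using d by (subst (asm) integral_nonneg_eq_0_iff_AE) auto
  thus ?thesis by (auto simp: d_def)
qed

text \<open>The Radon-Nikodym derivative of the push-forward of the measure with density \<open>f\<close>.\<close>

lemma transfer_operator_exists_nonneg:
  fixes f :: "'a \<Rightarrow> real"
  assumes M: "prob_space M" and T: "T \<in> measurable M M" and inv: "distr M M T = M"
    and f: "integrable M f" "\<And>x. 0 \<le> f x"
  obtains h :: "'a \<Rightarrow> real" where "integrable M h"
    "\<And>g :: 'a \<Rightarrow> complex. g \<in> borel_measurable M \<Longrightarrow>
      (\<integral>x. of_real (h x) * g x \<partial>M) = (\<integral>x. of_real (f x) * g (T x) \<partial>M)"
proof -
  interpret prob_space M by (rule M)
  note [measurable] = T
  have f_meas[measurable]: "f \<in> borel_measurable M" using f by auto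
  define \<nu> where "\<nu> = distr (density M (\<lambda>x. ennreal (f x))) M T"
  have sets_\<nu>: "sets \<nu> = sets M" by (simp add: \<nu>_def)
  have T': "T \<in> measurable (density M (\<lambda>x. ennreal (f x))) M" by simp
  \<comment> \<open>Invariance gives non-singularity: the preimage of a null set is null.\<close>
  have "absolutely_continuous M \<nu>"
    unfolding absolutely_continuous_def
  proof
    fix A assume A: "A \<in> null_sets M"
    hence A_sets[measurable]: "A \<in> sets M" by auto
    have "emeasure M (T -` A \<inter> space M) = emeasure (distr M M T) A"
      by (rule emeasure_distr[symmetric]) auto
    hence "T -` A \<inter> space M \<in> null_sets M" using A inv by (auto simp: null_sets_def)
    hence "AE x in M. x \<notin> T -` A \<inter> space M" by (rule AE_not_in)
    hence "emeasure \<nu> A = 0"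
      unfolding \<nu>_def using T'
      by (subst emeasure_distr) (auto simp: emeasure_density nn_integral_0_iff_AE indicator_def)
    thus "A \<in> null_sets \<nu>" by (auto simp: null_sets_def sets_\<nu>)
  qed
  from Radon_Nikodym[OF this sets_\<nu>] obtain h where
    h[measurable]: "h \<in> borel_measurable M" and h_dens: "density M h = \<nu>" by auto
  have "(\<integral>\<^sup>+ x. h x \<partial>M) = emeasure (density M h) (space M)"
    by (simp add: emeasure_density cong: nn_integral_cong)
  also have "\<dots> = (\<integral>\<^sup>+ x. ennreal (f x) \<partial>M)"
    unfolding h_dens \<nu>_def
    by (subst emeasure_distr[OF T']) (auto simp: emeasure_density measurable_space[OF T] intro!: nn_integral_cong)
  also have "\<dots> < \<infinity>" using f by (auto simp: integrable_iff_bounded)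
  finally have fin: "(\<integral>\<^sup>+ x. h x \<partial>M) < \<infinity>" .
  hence h_fin: "AE x in M. h x \<noteq> \<infinity>" by (intro nn_integral_noteq_infinite) auto
  hence h_eq: "AE x in M. ennreal (enn2real (h x)) = h x"
    by eventually_elim (simp add: less_top)
  have dens: "density M (\<lambda>x. ennreal (enn2real (h x))) = \<nu>"
    unfolding h_dens[symmetric] using h_eq by (intro density_cong) auto
  show thesis
  proof (rule that)
    show "integrable M (\<lambda>x. enn2real (h x))"
    proof (rule integrableI_nonneg)
      have "(\<integral>\<^sup>+ x. ennreal (enn2real (h x)) \<partial>M) = (\<integral>\<^sup>+ x. h x \<partial>M)"
        using h_eq by (rule nn_integral_cong_AE)
      thus "(\<integral>\<^sup>+ x. ennreal (enn2real (h x)) \<partial>M) < \<infinity>" using fin by simp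
    qed auto
    fix g :: "'a \<Rightarrow> complex" assume g[measurable]: "g \<in> borel_measurable M"
    have "(\<integral>x. of_real (enn2real (h x)) * g x \<partial>M) = (\<integral>x. g x \<partial>\<nu>)"
      unfolding dens[symmetric] by (subst integral_density) (auto simp: scaleR_conv_of_real)
    also have "\<dots> = (\<integral>x. g (T x) \<partial>density M (\<lambda>x. ennreal (f x)))"
      unfolding \<nu>_def by (rule integral_distr[OF T' g])
    also have "\<dots> = (\<integral>x. of_real (f x) * g (T x) \<partial>M)"
      using f(2) by (subst integral_density) (auto simp: scaleR_conv_of_real)
    finally show "(\<integral>x. of_real (enn2real (h x)) * g x \<partial>M) = (\<integral>x. of_real (f x) * g (T x) \<partial>M)" .
  qed
qed

lemma AE_comp_measure_preserving:
  assumes "T \<in> measurable M M" "distr M M T = M" "AE x in M. P x"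
  shows "AE x in M. P (T x)"
  by (rule AE_distrD[OF assms(1)]) (subst assms(2), rule assms(3))

text \<open>The operator is defined by choice, so all its properties rest on this existence.
  Positive and negative parts of the real and imaginary parts reduce it to the nonnegative
  case.\<close>

lemma transfer_operator_exists:
  fixes f :: "'a \<Rightarrow> complex"
  assumes M: "prob_space M" and T: "T \<in> measurable M M" and inv: "distr M M T = M"
    and f: "integrable M f"
  shows "\<exists>h. integrable M h \<and> (\<forall>g \<in> borel_measurable M. Linf_norm M g < \<infinity> \<longrightarrow>
           (\<integral>x. h x * g x \<partial>M) = (\<integral>x. f x * g (T x) \<partial>M))"
proof -
  have ex: "\<exists>h. integrable M h \<and> (\<forall>g :: 'a \<Rightarrow> complex. g \<in> borel_measurable M \<longrightarrow>
      (\<integral>x. of_real (h x) * g x \<partial>M) = (\<integral>x. of_real (k x) * g (T x) \<partial>M))"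
    if "integrable M k" "\<And>x. 0 \<le> k x" for k :: "'a \<Rightarrow> real"
    by (rule transfer_operator_exists_nonneg[OF M T inv that]) blast+
  let ?f1 = "\<lambda>x. max 0 (Re (f x))" and ?f2 = "\<lambda>x. max 0 (- Re (f x))"
  let ?f3 = "\<lambda>x. max 0 (Im (f x))" and ?f4 = "\<lambda>x. max 0 (- Im (f x))"
  have int_f: "integrable M ?f1" "integrable M ?f2" "integrable M ?f3" "integrable M ?f4"
    using f by auto
  obtain h1 where h1: "integrable M h1" "\<And>g :: 'a \<Rightarrow> complex. g \<in> borel_measurable M \<Longrightarrow>
      (\<integral>x. of_real (h1 x) * g x \<partial>M) = (\<integral>x. of_real (?f1 x) * g (T x) \<partial>M)"
    using ex[OF int_f(1) max.cobounded1] by blast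
  obtain h2 where h2: "integrable M h2" "\<And>g :: 'a \<Rightarrow> complex. g \<in> borel_measurable M \<Longrightarrow>
      (\<integral>x. of_real (h2 x) * g x \<partial>M) = (\<integral>x. of_real (?f2 x) * g (T x) \<partial>M)"
    using ex[OF int_f(2) max.cobounded1] by blast
  obtain h3 where h3: "integrable M h3" "\<And>g :: 'a \<Rightarrow> complex. g \<in> borel_measurable M \<Longrightarrow>
      (\<integral>x. of_real (h3 x) * g x \<partial>M) = (\<integral>x. of_real (?f3 x) * g (T x) \<partial>M)"
    using ex[OF int_f(3) max.cobounded1] by blast
  obtain h4 where h4: "integrable M h4" "\<And>g :: 'a \<Rightarrow> complex. g \<in> borel_measurable M \<Longrightarrow>
      (\<integral>x. of_real (h4 x) * g x \<partial>M) = (\<integral>x. of_real (?f4 x) * g (T x) \<partial>M)"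
    using ex[OF int_f(4) max.cobounded1] by blast
  define H where "H k1 k2 k3 k4 x = complex_of_real (k1 x) - of_real (k2 x)
      + \<i> * of_real (k3 x) - \<i> * of_real (k4 x)" for k1 k2 k3 k4 :: "'a \<Rightarrow> real" and x
  have int_H: "integrable M (H k1 k2 k3 k4)"
    if "integrable M k1" "integrable M k2" "integrable M k3" "integrable M k4" for k1 k2 k3 k4
    using that unfolding H_def by (intro Bochner_Integration.integrable_diff Bochner_Integration.integrable_add integrable_mult_right integrable_of_real)
  have lin: "(\<integral>x. H k1 k2 k3 k4 x * g x \<partial>M) =
      (\<integral>x. of_real (k1 x) * g x \<partial>M) - (\<integral>x. of_real (k2 x) * g x \<partial>M)
      + \<i> * (\<integral>x. of_real (k3 x) * g x \<partial>M) - \<i> * (\<integral>x. of_real (k4 x) * g x \<partial>M)"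
    if k: "integrable M k1" "integrable M k2" "integrable M k3" "integrable M k4"
      and g: "g \<in> borel_measurable M" "AE x in M. cmod (g x) \<le> c" for k1 k2 k3 k4 g c
  proof -
    have i: "integrable M (\<lambda>x. of_real (k x) * g x)" if "integrable M k" for k
      using that g by (intro integrable_mult_AE_bounded[OF _ g]) auto
    show ?thesis unfolding H_def left_diff_distrib distrib_right mult.assoc
      using i[OF k(1)] i[OF k(2)] i[OF k(3)] i[OF k(4)] by simp
  qed
  have f_eq: "f = H ?f1 ?f2 ?f3 ?f4"
    by (auto simp: H_def fun_eq_iff complex_eq_iff max_def)
  show ?thesis
  proof (intro exI[of _ "H h1 h2 h3 h4"] conjI ballI impI)
    show "integrable M (H h1 h2 h3 h4)" by (intro int_H h1 h2 h3 h4)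
    fix g assume g: "g \<in> borel_measurable M" "Linf_norm M g < \<infinity>"
    obtain c where c: "AE x in M. cmod (g x) \<le> c" using Linf_norm_finiteD[OF g(2)] by blast
    have gT: "(\<lambda>x. g (T x)) \<in> borel_measurable M" using g(1) T by (rule measurable_compose[rotated])
    have cT: "AE x in M. cmod (g (T x)) \<le> c" by (rule AE_comp_measure_preserving[OF T inv c])
    show "(\<integral>x. H h1 h2 h3 h4 x * g x \<partial>M) = (\<integral>x. f x * g (T x) \<partial>M)"
      unfolding lin[OF h1(1) h2(1) h3(1) h4(1) g(1) c] h1(2)[OF g(1)] h2(2)[OF g(1)] h3(2)[OF g(1)] h4(2)[OF g(1)]
      by (subst f_eq) (rule lin[OF int_f gT cT, symmetric])
  qed
qed

lemma le_zero_of_geometric_bound: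
  fixes a K s :: real
  assumes "\<And>n. a \<le> K * s ^ n" "0 \<le> s" "s < 1"
  shows "a \<le> 0"
proof (rule LIMSEQ_le_const)
  have "(\<lambda>n. K * s ^ n) \<longlonglongrightarrow> K * 0" using assms by (intro tendsto_intros LIMSEQ_realpow_zero) auto
  thus "(\<lambda>n. K * s ^ n) \<longlonglongrightarrow> 0" by simp
qed (use assms in auto)

section \<open>Contraction in L1, the leading eigenvalue and exponential decay\<close>

context property_C
begin

abbreviation \<tau> :: "('a \<Rightarrow> complex) \<Rightarrow> 'a \<Rightarrow> complex" where "\<tau> \<equiv> transfer_operator M T"

lemma
  assumes f: "integrable M f"
  shows integrable_transfer: "integrable M (\<tau> f)"
    and integral_transfer_mult: "g \<in> borel_measurable M \<Longrightarrow> Linf_norm M g < \<infinity> \<Longrightarrow>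
      (\<integral>x. \<tau> f x * g x \<partial>M) = (\<integral>x. f x * g (T x) \<partial>M)"
proof -
  have "integrable M (\<tau> f) \<and> (\<forall>g \<in> borel_measurable M. Linf_norm M g < \<infinity> \<longrightarrow>
           (\<integral>x. \<tau> f x * g x \<partial>M) = (\<integral>x. f x * g (T x) \<partial>M))"
    unfolding transfer_operator_def
    by (rule someI_ex[OF transfer_operator_exists[OF prob_space_axioms T_measurable invariant f]])
  thus "integrable M (\<tau> f)" "g \<in> borel_measurable M \<Longrightarrow> Linf_norm M g < \<infinity> \<Longrightarrow>
      (\<integral>x. \<tau> f x * g x \<partial>M) = (\<integral>x. f x * g (T x) \<partial>M)" by auto
qed

lemma AE_bounded: "f \<in> \<F> \<Longrightarrow> AE x in M. cmod (f x) \<le> nrm f"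
  using Linf_norm_le[of f] esssup_AE[where M = M and f = "\<lambda>x. ereal (cmod (f x))"]
  by (auto simp: Linf_norm_def elim!: eventually_mono) (metis ereal_less_eq(3) order_trans)

lemma Linf_norm_finite: "f \<in> \<F> \<Longrightarrow> Linf_norm M f < \<infinity>"
  using Linf_norm_le[of f] by (auto intro: order.strict_trans1)

lemma integrable_mem: "f \<in> \<F> \<Longrightarrow> integrable M f"
  using AE_bounded[of f] measurable by (intro integrable_const_bound[where B = "nrm f"]) auto

lemma norm_integral_le: assumes f: "f \<in> \<F>" shows "cmod (\<integral>x. f x \<partial>M) \<le> nrm f"
proof -
  have "cmod (\<integral>x. f x \<partial>M) \<le> (\<integral>x. cmod (f x) \<partial>M)" by (rule integral_norm_bound)
  also have "\<dots> \<le> (\<integral>x. nrm f \<partial>M)"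
    using AE_bounded[OF f] integrable_mem[OF f] by (intro integral_mono_AE) auto
  finally show ?thesis by (simp add: prob_space)
qed

lemma bounded_operator_transfer: "bounded_operator_on M \<F> nrm \<tau>"
  using spectral_gap by (simp add: has_spectral_gap_on_def)

lemma integral_transfer: "f \<in> \<F> \<Longrightarrow> (\<integral>x. \<tau> f x \<partial>M) = (\<integral>x. f x \<partial>M)"
  using integral_transfer_mult[OF integrable_mem, of f "\<lambda>x. 1"] Linf_norm_finite[OF const_mem, of 1] by simp

lemma funpow_transfer_mem: "f \<in> \<F> \<Longrightarrow> (\<tau> ^^ n) f \<in> \<F>"
  by (induction n) (auto intro: bounded_operator_mem[OF bounded_operator_transfer])

lemma integral_funpow_transfer: "f \<in> \<F> \<Longrightarrow> (\<integral>x. (\<tau> ^^ n) f x \<partial>M) = (\<integral>x. f x \<partial>M)"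
  by (induction n) (simp_all add: integral_transfer funpow_transfer_mem)

text \<open>By invariance the constant 1 itself satisfies the duality that determines its transfer
  almost everywhere.\<close>

lemma transfer_one: "AE x in M. \<tau> (\<lambda>x. 1) x = 1"
proof (rule AE_eq_of_integral_mult_eq)
  have 1: "integrable M (\<lambda>x. 1 :: complex)" by simp
  show "integrable M (\<tau> (\<lambda>x. 1))" by (rule integrable_transfer[OF 1])
  show "integrable M (\<lambda>x. 1 :: complex)" by (rule 1)
  fix g assume g: "g \<in> borel_measurable M" "Linf_norm M g < \<infinity>"
  have "(\<integral>x. g (T x) \<partial>M) = (\<integral>x. g x \<partial>distr M M T)"
    by (rule integral_distr[OF T_measurable g(1), symmetric])
  thus "(\<integral>x. \<tau> (\<lambda>x. 1) x * g x \<partial>M) = (\<integral>x. 1 * g x \<partial>M)"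
    unfolding integral_transfer_mult[OF 1 g] by (simp add: invariant)
qed

lemma nrm_one_ge: "1 \<le> nrm (\<lambda>x. 1)"
  using AE_bounded[OF const_mem, of 1] by (simp add: AE_const)

lemma nrm_const: "nrm (\<lambda>x. c) = cmod c * nrm (\<lambda>x. 1)"
  using nrm_scale[OF const_mem, of c 1] by simp

text \<open>The L1 contraction in dual form: pairing \<tau> h with the conjugate sign of
  \<open>h\<close> gives \<open>z\<close> times the L1 norm of \<open>h\<close>, whereas the dual
  side is at most that norm.\<close>

lemma transfer_eigenvalue_le_1:
  assumes h: "h \<in> \<F>" "\<not> (AE x in M. h x = 0)" and eig: "AE x in M. \<tau> h x = z * h x"
  shows "cmod z \<le> 1"
proof -
  define g where "g x = cnj (sgn (h x))" for x
  note int_h = integrable_mem[OF h(1)]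
  have h_meas: "h \<in> borel_measurable M" using int_h by auto
  have g_meas: "g \<in> borel_measurable M"
    unfolding g_def using h_meas by (rule borel_measurable_cnj_sgn)
  have g_bound: "cmod (g x) \<le> 1" for x by (simp add: g_def norm_sgn)
  have gT_meas: "(\<lambda>x. g (T x)) \<in> borel_measurable M"
    using g_meas T_measurable by (rule measurable_compose[rotated])
  define I where "I = (\<integral>x. cmod (h x) \<partial>M)"
  have "I \<noteq> 0"
    using h(2) int_h unfolding I_def by (subst integral_nonneg_eq_0_iff_AE) auto
  moreover have "I \<ge> 0" unfolding I_def by simp
  ultimately have I: "I > 0" by simp
  have "z * of_real I = (\<integral>x. z * (h x * g x) \<partial>M)"
    by (simp add: I_def g_def mult_cnj_sgn)
  also have "\<dots> = (\<integral>x. \<tau> h x * g x \<partial>M)"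
    using eig integrable_transfer[OF int_h] h_meas g_meas
    by (intro integral_cong_AE) (auto elim!: eventually_mono)
  also have "\<dots> = (\<integral>x. h x * g (T x) \<partial>M)"
    by (intro integral_transfer_mult[OF int_h g_meas] Linf_norm_finiteI[OF g_meas, of 1]) (simp add: g_bound)
  finally have "cmod z * I = cmod (\<integral>x. h x * g (T x) \<partial>M)"
    using I by (metis norm_mult norm_of_real abs_of_pos)
  also have "\<dots> \<le> (\<integral>x. cmod (h x * g (T x)) \<partial>M)" by (rule integral_norm_bound)
  also have "\<dots> \<le> I"
    unfolding I_def
    by (intro integral_mono integrable_norm integrable_mult_AE_bounded[OF int_h gT_meas, of 1] int_h)
       (auto simp: g_bound norm_mult intro: mult_left_le)
  finally show ?thesis using I by simp
qed

text \<open>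
  Since \<open>\<tau> 1 = 1\<close> and \<open>\<tau>\<close> is an \<open>L\<^sup>1\<close>-contraction, the spectral gap forces \<open>P f\<close> to be the
  constant \<open>\<integral>f\<close>, so that \<open>\<tau>\<close> acts as \<open>N\<close> on the functions with mean zero.
\<close>

lemma exponential_decay:
  obtains C s where "C > 0" "0 < s" "s < 1"
    "\<And>f n. f \<in> \<F> \<Longrightarrow> (\<integral>x. f x \<partial>M) = 0 \<Longrightarrow> nrm ((\<tau> ^^ n) f) \<le> C * s ^ n * nrm f"
proof -
  from spectral_gap obtain ev P N h where
    P: "bounded_operator_on M \<F> nrm P" and N: "bounded_operator_on M \<F> nrm N"
    and decomp: "\<And>f. f \<in> \<F> \<Longrightarrow> AE x in M. \<tau> f x = ev * P f x + N f x"
    and PP: "\<And>f. f \<in> \<F> \<Longrightarrow> AE x in M. P (P f) x = P f x"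
    and h: "h \<in> P ` \<F>" "\<not> (AE x in M. h x = 0)" "\<And>g. g \<in> P ` \<F> \<Longrightarrow> \<exists>c. AE x in M. g x = c * h x"
    and radius: "spectral_radius_on M \<F> nrm N < ennreal (cmod ev)"
    and PN: "\<And>f. f \<in> \<F> \<Longrightarrow> AE x in M. P (N f) x = 0"
    and NP: "\<And>f. f \<in> \<F> \<Longrightarrow> AE x in M. N (P f) x = 0"
    unfolding has_spectral_gap_on_def by blast
  obtain C s where C: "C > 0" and s: "0 < s" "s < cmod ev"
      and Npow: "\<And>f n. f \<in> \<F> \<Longrightarrow> nrm ((N ^^ n) f) \<le> C * s ^ n * nrm f"
    using funpow_bound_of_spectral_radius[OF N radius] by blast
  note memP = bounded_operator_mem[OF P] and memN = bounded_operator_mem[OF N]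
    and mem\<tau> = bounded_operator_mem[OF bounded_operator_transfer]
  have P\<tau>: "AE x in M. P (\<tau> f) x = ev * P f x" if f: "f \<in> \<F>" for f
  proof -
    have "AE x in M. P (\<tau> f) x = P (\<lambda>x. ev * P f x + N f x) x"
      by (intro bounded_operator_cong_AE[OF P _ _ decomp] add_mem scale_mem memP memN mem\<tau> f)
    moreover have "AE x in M. P (\<lambda>x. ev * P f x + N f x) x = P (\<lambda>x. ev * P f x) x + P (N f) x"
      by (intro bounded_operator_add[OF P] scale_mem memP memN f)
    moreover have "AE x in M. P (\<lambda>x. ev * P f x) x = ev * P (P f) x"
      by (intro bounded_operator_scale[OF P] memP f)
    ultimately show ?thesis using PN[OF f] PP[OF f] by eventually_elim simp
  qed
  have \<tau>P: "AE x in M. \<tau> (P f) x = ev * P f x" if f: "f \<in> \<F>" for f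
    using decomp[OF memP[OF f]] NP[OF f] PP[OF f] by eventually_elim simp
  have mem_Npow: "(N ^^ n) f \<in> \<F>" if "f \<in> \<F>" for n f
    using that by (induction n) (auto intro: memN)
  \<comment> \<open>The kernel of P is invariant under \<tau>, because P \<tau> = ev P, and on it
    \<tau> coincides with N.\<close>
  have pow_eq: "AE x in M. (\<tau> ^^ n) f x = (N ^^ n) f x" if f: "f \<in> \<F>" and 0: "AE x in M. P f x = 0" for f n
  proof -
    show ?thesis
    proof (induction n)
      case 0
      show ?case by simp
    next
      case (Suc n)
      have P0: "AE x in M. P ((\<tau> ^^ n) f) x = 0"
      proof (induction n)
        case 0
        show ?case using that(2) by simp
      next
        case (Suc n)
        then show ?case using P\<tau>[OF funpow_transfer_mem[OF f, of n]] by (auto elim: eventually_elim2)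
      qed
      have "AE x in M. N ((\<tau> ^^ n) f) x = N ((N ^^ n) f) x"
        by (intro bounded_operator_cong_AE[OF N _ _ Suc] funpow_transfer_mem mem_Npow f)
      with decomp[OF funpow_transfer_mem[OF f, of n]] P0 show ?case
        by eventually_elim simp
    qed
  qed
  have decay: "nrm ((\<tau> ^^ n) f) \<le> C * s ^ n * nrm f" if f: "f \<in> \<F>" and 0: "AE x in M. P f x = 0" for f n
    using nrm_cong_AE[OF funpow_transfer_mem[OF f] mem_Npow[OF f] pow_eq[OF f 0]] Npow[OF f] by simp
  obtain h' where h': "h' \<in> \<F>" "h = P h'" using h(1) by auto
  \<comment> \<open>Functions in the image of P are eigenfunctions for \<open>ev\<close>, so
    contraction bounds \<open>ev\<close> and thereby makes the decay rate \<open>s\<close> less than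
    1.\<close>
  have ev_le: "cmod ev \<le> 1"
    using transfer_eigenvalue_le_1[of h ev] h(2) h' memP \<tau>P[of h'] by auto
  hence s1: "s < 1" using s by simp
  let ?one = "\<lambda>x. 1 :: complex"
  \<comment> \<open>Along the orbit of a fixed function the norm is constant, but in the kernel of P
    it decays.\<close>
  have fixed_zero: "AE x in M. f x = 0"
    if f: "f \<in> \<F>" and 0: "AE x in M. P f x = 0" and inv: "AE x in M. \<tau> f x = f x" for f
  proof -
    have "AE x in M. (\<tau> ^^ n) f x = f x" for n
    proof (induction n)
      case (Suc n)
      have "AE x in M. \<tau> ((\<tau> ^^ n) f) x = \<tau> f x"
        by (intro bounded_operator_cong_AE[OF bounded_operator_transfer _ _ Suc] funpow_transfer_mem f)
      with inv show ?case by eventually_elim simp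
    qed simp
    hence "nrm f \<le> (C * nrm f) * s ^ n" for n
      using nrm_cong_AE[OF funpow_transfer_mem[OF f] f] decay[OF f 0, of n] by (simp add: mult_ac)
    hence "nrm f \<le> 0" using s s1 by (intro le_zero_of_geometric_bound[of _ "C * nrm f" s]) auto
    hence "nrm f = 0" using nrm_nonneg[OF f] by simp
    thus ?thesis using nrm_eq_0_iff[OF f] by simp
  qed
  \<comment> \<open>Otherwise the constant 1 would be a fixed function in the kernel of P and
    vanish. Since P 1 is not 0, \<tau> 1 = 1 will force \<open>ev\<close> = 1.\<close>
  have P1_ne: "\<not> (AE x in M. P ?one x = 0)"
    using fixed_zero[OF const_mem _ transfer_one] by auto
  have "AE x in M. P (\<tau> ?one) x = P ?one x"
    by (intro bounded_operator_cong_AE[OF P _ _ transfer_one] mem\<tau> const_mem)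
  with P\<tau>[OF const_mem, of 1] have "AE x in M. (ev - 1) * P ?one x = 0"
    by eventually_elim (simp add: algebra_simps)
  hence ev: "ev = 1" using P1_ne by auto
  define d where "d f x = f x - P f x" for f x
  have d_mem: "d f \<in> \<F>" if "f \<in> \<F>" for f unfolding d_def by (intro diff_mem memP that)
  have Pd: "AE x in M. P (d f) x = 0" if f: "f \<in> \<F>" for f
    using bounded_operator_diff[OF P f memP[OF f]] PP[OF f] unfolding d_def by eventually_elim simp
  \<comment> \<open>\<open>d\<close> maps into the kernel of P. Both 1 and P 1 are fixed by \<tau>,
    hence so is their difference, which must vanish.\<close>
  have "AE x in M. d ?one x = 0"
  proof (rule fixed_zero[OF d_mem[OF const_mem] Pd[OF const_mem]])
    show "AE x in M. \<tau> (d ?one) x = d ?one x"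
      using bounded_operator_diff[OF bounded_operator_transfer const_mem memP[OF const_mem], of 1 1]
        \<tau>P[OF const_mem, of 1] transfer_one unfolding d_def ev by eventually_elim simp
  qed
  hence P1: "AE x in M. P ?one x = 1" by eventually_elim (simp add: d_def)
  have P_zero: "AE x in M. P f x = 0" if f: "f \<in> \<F>" and int: "(\<integral>x. f x \<partial>M) = 0" for f
  proof -
    have "\<exists>c. AE x in M. P f x = c"
    proof -
      obtain c1 where c1: "AE x in M. P ?one x = c1 * h x" using h(3)[OF imageI[OF const_mem]] by blast
      obtain c where c: "AE x in M. P f x = c * h x" using h(3)[OF imageI[OF f]] by blast
      have c1_ne: "c1 \<noteq> 0" using c1 P1_ne by auto
      from c c1 P1 have "AE x in M. P f x = c / c1"
      proof eventually_elim
        case (elim x)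
        have "h x = 1 / c1" using elim c1_ne by (simp add: field_simps)
        thus ?case using elim by simp
      qed
      thus ?thesis by blast
    qed
    then obtain c where c: "AE x in M. P f x = c" by blast
    \<comment> \<open>\<tau> preserves integrals, while the norms of the iterates of
      \<open>d f\<close> tend to 0. So \<open>f\<close> and the constant P f have equal
      integrals.\<close>
    have "cmod (\<integral>x. d f x \<partial>M) \<le> (C * nrm (d f)) * s ^ n" for n
      using norm_integral_le[OF funpow_transfer_mem[OF d_mem[OF f]], of n]
        decay[OF d_mem[OF f] Pd[OF f], of n]
      by (simp add: integral_funpow_transfer d_mem f mult_ac)
    hence "cmod (\<integral>x. d f x \<partial>M) \<le> 0"
      using s s1 by (intro le_zero_of_geometric_bound[of _ "C * nrm (d f)" s]) auto
    moreover have "(\<integral>x. d f x \<partial>M) = (\<integral>x. f x \<partial>M) - (\<integral>x. P f x \<partial>M)"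
      unfolding d_def by (intro Bochner_Integration.integral_diff integrable_mem memP f)
    moreover have "(\<integral>x. P f x \<partial>M) = (\<integral>x. c \<partial>M)"
      using c integrable_mem[OF memP[OF f]] by (intro integral_cong_AE) auto
    ultimately have "c = 0" using int by (simp add: prob_space)
    thus ?thesis using c by simp
  qed
  show thesis by (rule that[OF C s(1) s1]) (intro decay P_zero)
qed

end

lemma (in property_C) funpow_measurable: "T ^^ n \<in> measurable M M"
proof (induction n)
  case (Suc n)
  show ?case unfolding funpow.simps by (rule measurable_comp[OF Suc T_measurable])
qed simp

section \<open>Exponential moments and deviations of orbit sums\<close>

text \<open>Duality moves T onto the test function: each application of the twisted operator shifts
  the remaining product by one step along the orbit and contributes the factor \<open>w\<close> at
  the starting point.\<close>

lemma (in property_C) integral_twisted_transfer: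
  assumes w: "w \<in> \<F>" and a: "a \<in> \<F>"
  shows "((\<lambda>f. \<tau> (\<lambda>x. w x * f x)) ^^ n) a \<in> \<F>"
    and "(\<integral>x. ((\<lambda>f. \<tau> (\<lambda>x. w x * f x)) ^^ n) a x \<partial>M) = (\<integral>x. a x * (\<Prod>i<n. w ((T ^^ i) x)) \<partial>M)"
proof -
  let ?L = "\<lambda>f. \<tau> (\<lambda>x. w x * f x)"
  have memL: "?L f \<in> \<F>" if "f \<in> \<F>" for f
    by (intro bounded_operator_mem[OF bounded_operator_transfer] mult_mem w that)
  show "(?L ^^ n) a \<in> \<F>" by (induction n) (use a memL in auto)
  have w_meas[measurable]: "w \<in> borel_measurable M" using w measurable by auto
  have [measurable]: "T ^^ i \<in> measurable M M" for i by (rule funpow_measurable)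
  have pres: "AE x in M. cmod (w ((T ^^ i) x)) \<le> nrm w" for i
  proof (induction i)
    case 0
    show ?case using AE_bounded[OF w] by simp
  next
    case (Suc i)
    from AE_comp_measure_preserving[OF T_measurable invariant Suc] show ?case
      by (simp add: funpow_swap1)
  qed
  \<comment> \<open>The product is the test function in the duality and therefore has to be
    essentially bounded.\<close>
  have bound: "AE x in M. cmod (\<Prod>i<n. w ((T ^^ i) x)) \<le> nrm w ^ n" for n
  proof -
    have "AE x in M. \<forall>i\<in>{..<n}. cmod (w ((T ^^ i) x)) \<le> nrm w"
      using pres by (intro AE_finite_allI) auto
    thus ?thesis
    proof eventually_elim
      case (elim x)
      have "cmod (\<Prod>i<n. w ((T ^^ i) x)) \<le> (\<Prod>i<n. nrm w)"
        unfolding prod_norm[symmetric] using elim by (intro prod_mono) auto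
      thus ?case by simp
    qed
  qed
  show "(\<integral>x. (?L ^^ n) a x \<partial>M) = (\<integral>x. a x * (\<Prod>i<n. w ((T ^^ i) x)) \<partial>M)"
    using a
  proof (induction n arbitrary: a)
    case (Suc n)
    define \<phi> where "\<phi> x = (\<Prod>i<n. w ((T ^^ i) x))" for x
    have \<phi>_meas: "\<phi> \<in> borel_measurable M" unfolding \<phi>_def by measurable
    have "(\<integral>x. (?L ^^ Suc n) a x \<partial>M) = (\<integral>x. (?L ^^ n) (?L a) x \<partial>M)"
      by (simp only: funpow_Suc_right comp_apply)
    also have "\<dots> = (\<integral>x. ?L a x * \<phi> x \<partial>M)"
      unfolding \<phi>_def by (rule Suc.IH[OF memL[OF Suc.prems]])
    also have "\<dots> = (\<integral>x. (w x * a x) * \<phi> (T x) \<partial>M)"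
      using bound[of n]
      by (intro integral_transfer_mult integrable_mem mult_mem w Suc.prems \<phi>_meas
            Linf_norm_finiteI[OF \<phi>_meas, of "nrm w ^ n"]) (simp add: \<phi>_def)
    also have "\<dots> = (\<integral>x. a x * (\<Prod>i<Suc n. w ((T ^^ i) x)) \<partial>M)"
      unfolding \<phi>_def prod.lessThan_Suc_shift by (simp add: funpow_swap1 mult_ac)
    finally show ?case .
  qed simp
qed

lemma (in property_C)
  assumes \<gamma>01: "\<And>x. x \<in> space M \<Longrightarrow> 0 \<le> \<gamma> x \<and> \<gamma> x \<le> 1" and t: "\<bar>t\<bar> \<le> (1 / 2 :: real)"
    and x: "x \<in> space M"
  shows orbit_factor_bounds: "1 - \<bar>t\<bar> \<le> 1 + t * \<gamma> ((T ^^ i) x)" "1 + t * \<gamma> ((T ^^ i) x) \<le> 2"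
    and orbit_product_nonneg: "0 \<le> (\<Prod>i<n. 1 + t * \<gamma> ((T ^^ i) x))"
    and orbit_product_le: "(\<Prod>i<n. 1 + t * \<gamma> ((T ^^ i) x)) \<le> 2 ^ n"
proof -
  have f: "1 - \<bar>t\<bar> \<le> 1 + t * \<gamma> ((T ^^ i) x) \<and> 1 + t * \<gamma> ((T ^^ i) x) \<le> 2" for i
  proof -
    have "(T ^^ i) x \<in> space M" using measurable_space[OF funpow_measurable x] .
    hence "\<bar>t * \<gamma> ((T ^^ i) x)\<bar> \<le> \<bar>t\<bar>" unfolding abs_mult using \<gamma>01 by (intro mult_left_le) auto
    thus ?thesis using t by auto
  qed
  thus "1 - \<bar>t\<bar> \<le> 1 + t * \<gamma> ((T ^^ i) x)" "1 + t * \<gamma> ((T ^^ i) x) \<le> 2" by auto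
  have nonneg: "0 \<le> 1 + t * \<gamma> ((T ^^ i) x)" for i using f[of i] t by linarith
  thus "0 \<le> (\<Prod>i<n. 1 + t * \<gamma> ((T ^^ i) x))" by (intro prod_nonneg) auto
  have "(\<Prod>i<n. 1 + t * \<gamma> ((T ^^ i) x)) \<le> (\<Prod>i<n. 2)"
    using f nonneg by (intro prod_mono) auto
  thus "(\<Prod>i<n. 1 + t * \<gamma> ((T ^^ i) x)) \<le> 2 ^ n" by simp
qed

lemma (in property_C) integrable_orbit_product:
  assumes [measurable]: "\<gamma> \<in> borel_measurable M"
    and \<gamma>01: "\<And>x. x \<in> space M \<Longrightarrow> 0 \<le> \<gamma> x \<and> \<gamma> x \<le> 1" and t: "\<bar>t\<bar> \<le> (1 / 2 :: real)"
  shows "integrable M (\<lambda>x. \<Prod>i<n. 1 + t * \<gamma> ((T ^^ i) x))"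
proof (rule integrable_const_bound)
  have [measurable]: "T ^^ i \<in> measurable M M" for i by (rule funpow_measurable)
  show "(\<lambda>x. \<Prod>i<n. 1 + t * \<gamma> ((T ^^ i) x)) \<in> borel_measurable M" by measurable
  show "AE x in M. norm (\<Prod>i<n. 1 + t * \<gamma> ((T ^^ i) x)) \<le> 2 ^ n"
  proof (rule AE_I2)
    fix x assume x: "x \<in> space M"
    show "norm (\<Prod>i<n. 1 + t * \<gamma> ((T ^^ i) x)) \<le> 2 ^ n"
      using orbit_product_nonneg[where \<gamma> = \<gamma> and n = n, OF \<gamma>01 t x] orbit_product_le[where \<gamma> = \<gamma> and n = n, OF \<gamma>01 t x]
      by (simp only: real_norm_def abs_of_nonneg)
  qed
qed

text \<open>
  Splitting the iterates of the twisted operator into their integrals and mean-zero parts, the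
  decay keeps the latter of relative size \<open>O(t)\<close>, and integrating them against the small
  function \<open>\<gamma>\<close> gains another factor \<open>t\<integral>\<gamma>\<close>.
\<close>

lemma (in property_C) product_moment_bound:
  fixes K :: real
  obtains D t0 where "D > 0" "0 < t0" "t0 \<le> 1 / 2"
    "\<And>\<gamma> t n. (\<lambda>x. complex_of_real (\<gamma> x)) \<in> \<F> \<Longrightarrow> nrm (\<lambda>x. complex_of_real (\<gamma> x)) \<le> K \<Longrightarrow>
      (\<And>x. x \<in> space M \<Longrightarrow> 0 \<le> \<gamma> x \<and> \<gamma> x \<le> 1) \<Longrightarrow> \<bar>t\<bar> \<le> t0 \<Longrightarrow>
      (\<integral>x. (\<Prod>i<n. 1 + t * \<gamma> ((T ^^ i) x)) \<partial>M) \<le> exp (n * (\<integral>x. \<gamma> x \<partial>M) * (t + D * t\<^sup>2))"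
proof -
  obtain C s where C: "C > 0" and s: "0 < s" "s < 1" and
    decay: "\<And>f n. f \<in> \<F> \<Longrightarrow> (\<integral>x. f x \<partial>M) = 0 \<Longrightarrow> nrm ((\<tau> ^^ n) f) \<le> C * s ^ n * nrm f"
    using exponential_decay by blast
  obtain K0 where K0: "K0 > 0" "\<And>f. f \<in> \<F> \<Longrightarrow> nrm (\<tau> f) \<le> K0 * nrm f"
    using bounded_operator_bound[OF bounded_operator_transfer] by blast
  define o1 where "o1 = nrm (\<lambda>x. 1)"
  have o1: "o1 \<ge> 1" unfolding o1_def by (rule nrm_one_ge)
  \<comment> \<open>\<open>Q\<close> bounds C times the norm of the forcing term \<open>z n\<close>
    relative to the norm of \<open>a n\<close>. \<open>D\<close> and \<open>t0\<close> are solved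
    from \<open>t0_D\<close>, the inequality that closes the induction in \<open>v_nrm\<close>; the
    + 1 in \<open>D\<close> keeps it positive if Q = 0.\<close>
  define Q where "Q = C * \<bar>K\<bar> * (K0 + o1)"
  have Q: "Q \<ge> 0" using C K0 o1 by (simp add: Q_def)
  define D where "D = 2 * (Q * o1 + 1) / (1 - s)"
  have D: "D > 0" using s Q o1 by (auto simp: D_def intro!: divide_pos_pos add_nonneg_pos)
  define t0 where "t0 = min (1 / 2) ((1 - s) / (2 * (Q + 1)))"
  have t0: "0 < t0" "t0 \<le> 1 / 2" using s Q by (auto simp: t0_def intro!: divide_pos_pos)
  have t0_D: "s * D + Q * (o1 + D * t) \<le> D * (1 - t)" if "0 \<le> t" "t \<le> t0" for t
  proof -
    have "t * (Q + 1) \<le> ((1 - s) / (2 * (Q + 1))) * (Q + 1)"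
      using that Q by (intro mult_right_mono) (auto simp: t0_def)
    also have "\<dots> = (1 - s) / 2"
    proof -
      have "x / (2 * r) * r = x / 2" if "r \<noteq> 0" for x r :: real using that by simp
      from this[of "Q + 1" "1 - s"] show ?thesis using Q by linarith
    qed
    finally have "t * (Q + 1) \<le> (1 - s) / 2" .
    hence "D * (t * (Q + 1)) \<le> D * ((1 - s) / 2)" using D by (intro mult_left_mono) auto
    moreover have "D * ((1 - s) / 2) = Q * o1 + 1" using s by (simp add: D_def field_simps)
    ultimately show ?thesis by (simp add: algebra_simps)
  qed
  show thesis
  proof (rule that[OF D t0])
    fix \<gamma> :: "'a \<Rightarrow> real" and t :: real and n :: nat
    assume \<gamma>_mem: "(\<lambda>x. complex_of_real (\<gamma> x)) \<in> \<F>" and \<gamma>_nrm: "nrm (\<lambda>x. complex_of_real (\<gamma> x)) \<le> K"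
      and \<gamma>01: "\<And>x. x \<in> space M \<Longrightarrow> 0 \<le> \<gamma> x \<and> \<gamma> x \<le> 1" and t: "\<bar>t\<bar> \<le> t0"
    define g where "g = (\<lambda>x. complex_of_real (\<gamma> x))"
    have g: "g \<in> \<F>" "nrm g \<le> \<bar>K\<bar>" using \<gamma>_mem \<gamma>_nrm by (auto simp: g_def)
    have \<gamma>_int: "integrable M \<gamma>"
      using integrable_Re[OF integrable_mem[OF \<gamma>_mem]] by simp
    have \<gamma>_meas[measurable]: "\<gamma> \<in> borel_measurable M" using \<gamma>_int by auto
    have [measurable]: "T ^^ i \<in> measurable M M" for i by (rule funpow_measurable)
    define m where "m = (\<integral>x. \<gamma> x \<partial>M)"
    have m: "m \<ge> 0" unfolding m_def using \<gamma>01 by (intro integral_nonneg_AE) auto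
    define W where "W n x = (\<Prod>i<n. 1 + t * \<gamma> ((T ^^ i) x))" for n x
    have W_meas[measurable]: "W n \<in> borel_measurable M" for n unfolding W_def by measurable
    have t_half: "\<bar>t\<bar> \<le> 1 / 2" using t t0 by simp
    have factor: "1 - \<bar>t\<bar> \<le> 1 + t * \<gamma> ((T ^^ i) x)" if "x \<in> space M" for i x
      by (rule orbit_factor_bounds[OF _ t_half that]) (rule \<gamma>01)
    have W_nonneg: "0 \<le> W n x" if "x \<in> space M" for n x
      unfolding W_def by (rule orbit_product_nonneg[OF _ t_half that]) (rule \<gamma>01)
    have W_int: "integrable M (W n)" for n
      unfolding W_def by (rule integrable_orbit_product[OF \<gamma>_meas \<gamma>01 t_half])
    define u where "u n = (\<integral>x. W n x \<partial>M)" for n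
    have u_nonneg: "0 \<le> u n" for n unfolding u_def using W_nonneg by (intro integral_nonneg_AE) auto
    \<comment> \<open>The induction in \<open>v_nrm\<close> has to replace u_n by u_(n+1) in its
      bound. For negative \<open>t\<close> the sequence may decrease, but by no more than the factor
      1 - |t|.\<close>
    have u_Suc_ge: "(1 - \<bar>t\<bar>) * u n \<le> u (Suc n)" for n
    proof -
      have "(1 - \<bar>t\<bar>) * u n = (\<integral>x. (1 - \<bar>t\<bar>) * W n x \<partial>M)" by (simp add: u_def)
      also have "\<dots> \<le> u (Suc n)"
        unfolding u_def
      proof (rule integral_mono)
        show "(1 - \<bar>t\<bar>) * W n x \<le> W (Suc n) x" if "x \<in> space M" for x
          using mult_right_mono[OF factor[OF that, of n] W_nonneg[OF that, of n]]
          by (simp add: W_def mult.commute)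
      qed (use W_int in auto)
      finally show ?thesis .
    qed
    define w where "w x = 1 + of_real t * g x" for x
    have w: "w \<in> \<F>" unfolding w_def by (intro add_mem scale_mem const_mem g)
    define a where "a n = ((\<lambda>f. \<tau> (\<lambda>x. w x * f x)) ^^ n) (\<lambda>x. 1)" for n
    have a_mem: "a n \<in> \<F>" for n
      unfolding a_def by (rule integral_twisted_transfer[OF w const_mem])
    have a_Suc: "a (Suc n) = \<tau> (\<lambda>x. w x * a n x)" for n by (simp add: a_def)
    have a_int: "(\<integral>x. a n x \<partial>M) = of_real (u n)" for n
    proof -
      have "(\<integral>x. a n x \<partial>M) = (\<integral>x. complex_of_real (W n x) \<partial>M)"
        unfolding a_def integral_twisted_transfer(2)[OF w const_mem] by (simp add: W_def w_def g_def)
      thus ?thesis by (simp add: u_def)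
    qed
    define v where "v n x = a n x - of_real (u n)" for n x
    have v_mem: "v n \<in> \<F>" for n unfolding v_def by (intro diff_mem a_mem const_mem)
    have ga_mem: "(\<lambda>x. g x * a n x) \<in> \<F>" for n by (intro mult_mem g a_mem)
    have gv_mem: "(\<lambda>x. g x * v n x) \<in> \<F>" for n by (intro mult_mem g v_mem)
    define I where "I n = (\<integral>x. g x * a n x \<partial>M)" for n
    have u_Suc: "complex_of_real (u (Suc n)) = of_real (u n) + of_real t * I n" for n
    proof -
      have "complex_of_real (u (Suc n)) = (\<integral>x. w x * a n x \<partial>M)"
        unfolding a_int[symmetric] a_Suc by (intro integral_transfer mult_mem w a_mem)
      also have "\<dots> = (\<integral>x. a n x + of_real t * (g x * a n x) \<partial>M)"
        by (intro Bochner_Integration.integral_cong) (auto simp: w_def algebra_simps)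
      also have "\<dots> = (\<integral>x. a n x \<partial>M) + (\<integral>x. of_real t * (g x * a n x) \<partial>M)"
        by (intro Bochner_Integration.integral_add integrable_mem scale_mem a_mem ga_mem)
      finally show ?thesis by (simp add: a_int I_def)
    qed
    have I_eq: "I n = of_real (m * u n) + (\<integral>x. g x * v n x \<partial>M)" for n
    proof -
      have "I n = (\<integral>x. of_real (u n) * g x + g x * v n x \<partial>M)"
        unfolding I_def by (intro Bochner_Integration.integral_cong) (auto simp: v_def algebra_simps)
      also have "\<dots> = (\<integral>x. of_real (u n) * g x \<partial>M) + (\<integral>x. g x * v n x \<partial>M)"
        by (intro Bochner_Integration.integral_add integrable_mem scale_mem g gv_mem)
      also have "(\<integral>x. of_real (u n) * g x \<partial>M) = of_real (m * u n)"
        by (simp add: m_def g_def)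
      finally show ?thesis .
    qed
    have gv_le: "cmod (\<integral>x. g x * v n x \<partial>M) \<le> nrm (v n) * m" for n
    proof -
      have "cmod (\<integral>x. g x * v n x \<partial>M) \<le> (\<integral>x. cmod (g x * v n x) \<partial>M)" by (rule integral_norm_bound)
      also have "\<dots> \<le> (\<integral>x. nrm (v n) * \<gamma> x \<partial>M)"
      proof (rule integral_mono_AE)
        show "AE x in M. cmod (g x * v n x) \<le> nrm (v n) * \<gamma> x"
          using AE_bounded[OF v_mem[of n]] AE_space
          by eventually_elim (use \<gamma>01 in \<open>auto simp: g_def norm_mult mult.commute intro: mult_left_mono\<close>)
      qed (use integrable_mem[OF gv_mem] \<gamma>_int in auto)
      finally show ?thesis by (simp add: m_def)
    qed
    \<comment> \<open>The mean-zero part of \<tau> (g a_n). It is the forcing term in v_(n+1) =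
      \<tau> v_n + t z_n, where the constant parts cancel thanks to \<tau> 1 = 1.\<close>
    define z where "z n x = \<tau> (\<lambda>x. g x * a n x) x - I n" for n x
    have \<tau>_mem: "\<tau> f \<in> \<F>" if "f \<in> \<F>" for f by (rule bounded_operator_mem[OF bounded_operator_transfer that])
    have z_mem: "z n \<in> \<F>" for n unfolding z_def by (intro diff_mem \<tau>_mem ga_mem const_mem)
    have z_int: "(\<integral>x. z n x \<partial>M) = 0" for n
    proof -
      have "(\<integral>x. z n x \<partial>M) = (\<integral>x. \<tau> (\<lambda>x. g x * a n x) x \<partial>M) - (\<integral>x. I n \<partial>M)"
        unfolding z_def by (intro Bochner_Integration.integral_diff integrable_mem \<tau>_mem ga_mem const_mem)
      thus ?thesis by (simp add: integral_transfer[OF ga_mem] I_def prob_space)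
    qed
    have z_nrm: "C * nrm (z n) \<le> Q * nrm (a n)" for n
    proof -
      have ga: "nrm (\<lambda>x. g x * a n x) \<le> \<bar>K\<bar> * nrm (a n)"
        using nrm_mult[OF g(1) a_mem[of n]] mult_right_mono[OF g(2) nrm_nonneg[OF a_mem[of n]]] by linarith
      have "nrm (z n) \<le> nrm (\<tau> (\<lambda>x. g x * a n x)) + nrm (\<lambda>x. I n)"
        unfolding z_def by (intro nrm_diff \<tau>_mem ga_mem const_mem)
      also have "\<dots> \<le> K0 * nrm (\<lambda>x. g x * a n x) + cmod (I n) * o1"
        unfolding o1_def nrm_const[of "I n"] by (intro add_right_mono K0(2) ga_mem)
      also have "\<dots> \<le> K0 * (\<bar>K\<bar> * nrm (a n)) + (\<bar>K\<bar> * nrm (a n)) * o1"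
        using ga K0(1) o1 norm_integral_le[OF ga_mem[of n]] unfolding I_def
        by (intro add_mono mult_left_mono mult_right_mono) auto
      finally have "C * nrm (z n) \<le> C * (K0 * (\<bar>K\<bar> * nrm (a n)) + (\<bar>K\<bar> * nrm (a n)) * o1)"
        using C by (intro mult_left_mono) auto
      thus ?thesis by (simp add: Q_def algebra_simps)
    qed
    have v_Suc: "AE x in M. v (Suc n) x = \<tau> (v n) x + of_real t * z n x" for n
    proof -
      let ?b = "\<lambda>x. of_real (u n) * 1 + of_real t * (g x * a n x)"
      have b: "?b \<in> \<F>" by (intro add_mem scale_mem const_mem ga_mem)
      have "(\<lambda>x. w x * a n x) = (\<lambda>x. v n x + ?b x)" by (auto simp: w_def v_def algebra_simps)
      hence "AE x in M. a (Suc n) x = \<tau> (v n) x + \<tau> ?b x"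
        unfolding a_Suc using bounded_operator_add[OF bounded_operator_transfer v_mem[of n] b] by simp
      moreover have "AE x in M. \<tau> ?b x = \<tau> (\<lambda>x. of_real (u n) * 1) x + \<tau> (\<lambda>x. of_real t * (g x * a n x)) x"
        by (intro bounded_operator_add[OF bounded_operator_transfer] scale_mem const_mem ga_mem)
      moreover have "AE x in M. \<tau> (\<lambda>x. of_real (u n) * 1) x = of_real (u n) * \<tau> (\<lambda>x. 1) x"
        by (intro bounded_operator_scale[OF bounded_operator_transfer] const_mem)
      moreover have "AE x in M. \<tau> (\<lambda>x. of_real t * (g x * a n x)) x = of_real t * \<tau> (\<lambda>x. g x * a n x) x"
        by (intro bounded_operator_scale[OF bounded_operator_transfer] ga_mem)
      ultimately show ?thesis using transfer_one
        by eventually_elim (simp add: v_def z_def u_Suc algebra_simps)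
    qed
    have pow_v_Suc: "AE x in M. (\<tau> ^^ i) (v (Suc n)) x = (\<tau> ^^ Suc i) (v n) x + of_real t * (\<tau> ^^ i) (z n) x" for i n
    proof (induction i)
      case 0
      then show ?case using v_Suc by simp
    next
      case (Suc i)
      note mems = funpow_transfer_mem[OF v_mem] funpow_transfer_mem[OF z_mem]
      have "AE x in M. \<tau> ((\<tau> ^^ i) (v (Suc n))) x = \<tau> (\<lambda>x. (\<tau> ^^ Suc i) (v n) x + of_real t * (\<tau> ^^ i) (z n) x) x"
        by (intro bounded_operator_cong_AE[OF bounded_operator_transfer _ _ Suc] add_mem scale_mem mems)
      moreover have "AE x in M. \<tau> (\<lambda>x. (\<tau> ^^ Suc i) (v n) x + of_real t * (\<tau> ^^ i) (z n) x) x =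
          \<tau> ((\<tau> ^^ Suc i) (v n)) x + \<tau> (\<lambda>x. of_real t * (\<tau> ^^ i) (z n) x) x"
        by (intro bounded_operator_add[OF bounded_operator_transfer] scale_mem mems)
      moreover have "AE x in M. \<tau> (\<lambda>x. of_real t * (\<tau> ^^ i) (z n) x) x = of_real t * \<tau> ((\<tau> ^^ i) (z n)) x"
        by (intro bounded_operator_scale[OF bounded_operator_transfer] mems)
      ultimately show ?case by eventually_elim simp
    qed
    \<comment> \<open>All iterates \<tau>^i v_n are treated at once, since a single application of
      \<tau> need not contract the norm. With s^i built into the claim, passing from i to i + 1
      gains a factor \<open>s\<close>, and the decay constant \<open>C\<close> enters only through
      the forcing term.\<close>
    have v_nrm: "nrm ((\<tau> ^^ i) (v n)) \<le> s ^ i * (D * \<bar>t\<bar> * u n)" for i n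
    proof (induction n arbitrary: i)
      case 0
      have "u 0 = 1" by (simp add: u_def W_def prob_space)
      hence "v 0 = (\<lambda>x. 0)" by (simp add: v_def a_def fun_eq_iff)
      hence "nrm ((\<tau> ^^ i) (v 0)) \<le> C * s ^ i * 0" using decay[OF zero_mem, of i] by (simp add: nrm_zero)
      then show ?case using s D u_nonneg[of 0] by (auto intro!: mult_nonneg_nonneg elim: order_trans)
    next
      case (Suc n)
      have a_nrm: "nrm (a n) \<le> u n * (o1 + D * \<bar>t\<bar>)"
      proof -
        have "a n = (\<lambda>x. v n x + of_real (u n))" by (simp add: v_def fun_eq_iff)
        hence "nrm (a n) \<le> nrm (v n) + nrm (\<lambda>x. of_real (u n))"
          using nrm_add[OF v_mem const_mem, of n "of_real (u n)"] by simp
        also have "\<dots> \<le> D * \<bar>t\<bar> * u n + u n * o1"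
          using Suc[of 0] u_nonneg[of n] unfolding nrm_const[of "of_real (u n)"] o1_def by simp
        finally show ?thesis by (simp add: algebra_simps)
      qed
      have "nrm ((\<tau> ^^ i) (v (Suc n))) = nrm (\<lambda>x. (\<tau> ^^ Suc i) (v n) x + of_real t * (\<tau> ^^ i) (z n) x)"
        by (intro nrm_cong_AE pow_v_Suc add_mem scale_mem funpow_transfer_mem v_mem z_mem)
      also have "\<dots> \<le> nrm ((\<tau> ^^ Suc i) (v n)) + nrm (\<lambda>x. of_real t * (\<tau> ^^ i) (z n) x)"
        by (intro nrm_add scale_mem funpow_transfer_mem v_mem z_mem)
      also have "nrm (\<lambda>x. of_real t * (\<tau> ^^ i) (z n) x) = \<bar>t\<bar> * nrm ((\<tau> ^^ i) (z n))"
        using nrm_scale[OF funpow_transfer_mem[OF z_mem]] by simp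
      also have "nrm ((\<tau> ^^ Suc i) (v n)) + \<bar>t\<bar> * nrm ((\<tau> ^^ i) (z n))
          \<le> s ^ Suc i * (D * \<bar>t\<bar> * u n) + \<bar>t\<bar> * (C * s ^ i * nrm (z n))"
        by (intro add_mono mult_left_mono decay Suc z_mem z_int) auto
      also have "\<dots> = s ^ i * \<bar>t\<bar> * (s * D * u n + C * nrm (z n))" by (simp add: algebra_simps)
      also have "\<dots> \<le> s ^ i * \<bar>t\<bar> * (s * D * u n + Q * (u n * (o1 + D * \<bar>t\<bar>)))"
        using s Q a_nrm z_nrm[of n]
        by (intro mult_left_mono add_left_mono) (auto intro: order_trans mult_left_mono)
      also have "\<dots> = s ^ i * \<bar>t\<bar> * ((s * D + Q * (o1 + D * \<bar>t\<bar>)) * u n)" by (simp add: algebra_simps)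
      also have "\<dots> \<le> s ^ i * \<bar>t\<bar> * ((D * (1 - \<bar>t\<bar>)) * u n)"
        using t0_D[of "\<bar>t\<bar>"] t s u_nonneg[of n] by (intro mult_left_mono mult_right_mono) auto
      also have "\<dots> = s ^ i * \<bar>t\<bar> * (D * ((1 - \<bar>t\<bar>) * u n))" by (simp add: algebra_simps)
      also have "\<dots> \<le> s ^ i * \<bar>t\<bar> * (D * u (Suc n))"
        using u_Suc_ge[of n] D s by (intro mult_left_mono) auto
      finally show ?case by (simp add: mult_ac)
    qed
    \<comment> \<open>The mean of a_n contributes t m u_n, its mean-zero part at most D m t^2 u_n by
      \<open>gv_le\<close> and \<open>v_nrm\<close>. The common factor \<open>m\<close> puts both
      into one exponent.\<close>
    have step: "u (Suc n) \<le> u n * exp (m * (t + D * t\<^sup>2))" for n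
    proof -
      have "u (Suc n) = Re (complex_of_real (u (Suc n)))" by simp
      also have "\<dots> = u n + t * (m * u n) + t * Re (\<integral>x. g x * v n x \<partial>M)"
        unfolding u_Suc I_eq by (simp add: algebra_simps)
      also have "\<dots> \<le> u n + t * (m * u n) + \<bar>t\<bar> * ((D * \<bar>t\<bar> * u n) * m)"
      proof -
        have "t * Re (\<integral>x. g x * v n x \<partial>M) \<le> \<bar>t\<bar> * \<bar>Re (\<integral>x. g x * v n x \<partial>M)\<bar>"
          by (metis abs_ge_self abs_mult)
        also have "\<dots> \<le> \<bar>t\<bar> * (nrm (v n) * m)"
          using abs_Re_le_cmod gv_le by (intro mult_left_mono) (auto intro: order_trans)
        also have "\<dots> \<le> \<bar>t\<bar> * ((D * \<bar>t\<bar> * u n) * m)"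
          using v_nrm[of 0 n] m by (intro mult_left_mono mult_right_mono) auto
        finally show ?thesis by simp
      qed
      also have "\<dots> = u n * (1 + m * (t + D * \<bar>t\<bar>\<^sup>2))" by (simp add: algebra_simps power2_eq_square)
      also have "\<dots> \<le> u n * exp (m * (t + D * t\<^sup>2))"
        using u_nonneg[of n] by (intro mult_left_mono) (simp_all add: exp_ge_add_one_self)
      finally show ?thesis .
    qed
    have "u n \<le> exp (n * m * (t + D * t\<^sup>2))"
    proof (induction n)
      case 0
      show ?case by (simp add: u_def W_def prob_space)
    next
      case (Suc n)
      have "u (Suc n) \<le> exp (n * m * (t + D * t\<^sup>2)) * exp (m * (t + D * t\<^sup>2))"
        by (rule order_trans[OF step mult_right_mono[OF Suc]]) simp
      thus ?case by (simp add: exp_add[symmetric] algebra_simps)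
    qed
    thus "(\<integral>x. (\<Prod>i<n. 1 + t * \<gamma> ((T ^^ i) x)) \<partial>M) \<le> exp (n * (\<integral>x. \<gamma> x \<partial>M) * (t + D * t\<^sup>2))"
      by (simp add: u_def W_def m_def)
  qed
qed

text \<open>A consequence of |ln (1 + y) - y| \<le> 2 y^2. It bounds the products from below by
  exponentials of orbit sums, the form that Chernoff's method needs.\<close>

lemma exp_quadratic_le_one_plus:
  fixes y :: real
  assumes "\<bar>y\<bar> \<le> 1 / 2"
  shows "exp (y - 2 * y\<^sup>2) \<le> 1 + y"
proof -
  have "y - 2 * y\<^sup>2 \<le> ln (1 + y)"
    using abs_ln_one_plus_x_minus_x_bound[OF assms] by linarith
  moreover have "1 + y > 0" using assms by linarith
  ultimately show ?thesis by (metis exp_le_cancel_iff exp_ln)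
qed

text \<open>Both tails come from one Markov estimate for the product, with parameter
  \<open>t\<close> for an excess and -t for a deficit of the sum.\<close>

lemma (in property_C) orbit_sum_deviation:
  fixes K \<epsilon> :: real
  assumes \<epsilon>: "\<epsilon> > 0"
  obtains c where "c > 0"
    "\<And>\<gamma> n. (\<lambda>x. complex_of_real (\<gamma> x)) \<in> \<F> \<Longrightarrow> nrm (\<lambda>x. complex_of_real (\<gamma> x)) \<le> K \<Longrightarrow>
      (\<And>x. x \<in> space M \<Longrightarrow> 0 \<le> \<gamma> x \<and> \<gamma> x \<le> 1) \<Longrightarrow>
      prob {x \<in> space M. \<bar>(\<Sum>i<n. \<gamma> ((T ^^ i) x)) - n * (\<integral>x. \<gamma> x \<partial>M)\<bar> \<ge> \<epsilon> * (n * (\<integral>x. \<gamma> x \<partial>M))}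
        \<le> 2 * exp (- c * (n * (\<integral>x. \<gamma> x \<partial>M)))"
proof -
  obtain D t0 where D: "D > 0" and t0: "0 < t0" "t0 \<le> 1 / 2" and moment:
    "\<And>\<gamma> t n. (\<lambda>x. complex_of_real (\<gamma> x)) \<in> \<F> \<Longrightarrow> nrm (\<lambda>x. complex_of_real (\<gamma> x)) \<le> K \<Longrightarrow>
      (\<And>x. x \<in> space M \<Longrightarrow> 0 \<le> \<gamma> x \<and> \<gamma> x \<le> 1) \<Longrightarrow> \<bar>t\<bar> \<le> t0 \<Longrightarrow>
      (\<integral>x. (\<Prod>i<n. 1 + t * \<gamma> ((T ^^ i) x)) \<partial>M) \<le> exp (n * (\<integral>x. \<gamma> x \<partial>M) * (t + D * t\<^sup>2))"
    using product_moment_bound[of K] by blast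
  \<comment> \<open>The coefficient of t^2 in the upper-tail exponent: \<open>D\<close> from the
    moment bound and 2 (1 + \<epsilon>) from the loss 2 r^2. The lower tail has a smaller one. The
    choice of \<open>t\<close> lets half of t \<epsilon> survive, and this is
    \<open>c\<close>.\<close>
  define E where "E = D + 2 + 2 * \<epsilon>"
  have E: "E > 0" using D \<epsilon> by (simp add: E_def)
  define t where "t = min t0 (\<epsilon> / (2 * E))"
  have t: "0 < t" "t \<le> t0" using t0 \<epsilon> E by (auto simp: t_def)
  have "t * E \<le> \<epsilon> / (2 * E) * E" using E by (intro mult_right_mono) (auto simp: t_def)
  hence tE: "t * E \<le> \<epsilon> / 2" using E by simp
  define c where "c = t * \<epsilon> / 2"
  have c: "c > 0" using t \<epsilon> by (simp add: c_def)
  have "t * (t * E) \<le> t * (\<epsilon> / 2)" using tE t by (intro mult_left_mono) auto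
  hence t2E: "t\<^sup>2 * E \<le> t * \<epsilon> - c" by (simp add: c_def power2_eq_square algebra_simps)
  show thesis
  proof (rule that[OF c])
    fix \<gamma> :: "'a \<Rightarrow> real" and n :: nat
    assume \<gamma>: "(\<lambda>x. complex_of_real (\<gamma> x)) \<in> \<F>" "nrm (\<lambda>x. complex_of_real (\<gamma> x)) \<le> K"
      and \<gamma>01: "\<And>x. x \<in> space M \<Longrightarrow> 0 \<le> \<gamma> x \<and> \<gamma> x \<le> 1"
    have [measurable]: "\<gamma> \<in> borel_measurable M"
      using integrable_Re[OF integrable_mem[OF \<gamma>(1)]] by simp
    have [measurable]: "T ^^ i \<in> measurable M M" for i by (rule funpow_measurable)
    define S where "S x = (\<Sum>i<n. \<gamma> ((T ^^ i) x))" for x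
    have [measurable]: "S \<in> borel_measurable M" unfolding S_def by measurable
    define m where "m = (\<integral>x. \<gamma> x \<partial>M)"
    have m: "m \<ge> 0" unfolding m_def using \<gamma>01 by (intro integral_nonneg_AE) auto
    have tail: "prob {x \<in> space M. (r - 2 * r\<^sup>2) * S x \<ge> b} \<le> exp (n * m * (r + D * r\<^sup>2) - b)"
      if r: "\<bar>r\<bar> \<le> t0" for r b
    proof -
      have r_half: "\<bar>r\<bar> \<le> 1 / 2" using r t0 by simp
      define W where "W x = (\<Prod>i<n. 1 + r * \<gamma> ((T ^^ i) x))" for x
      have W: "integrable M W" "AE x in M. 0 \<le> W x"
        unfolding W_def using integrable_orbit_product[where \<gamma> = \<gamma>, OF _ \<gamma>01 r_half] orbit_product_nonneg[where \<gamma> = \<gamma>, OF \<gamma>01 r_half]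
        by auto
      have W_ge: "exp ((r - 2 * r\<^sup>2) * S x) \<le> W x" if x: "x \<in> space M" for x
      proof -
        have "exp ((r - 2 * r\<^sup>2) * S x) = (\<Prod>i<n. exp ((r - 2 * r\<^sup>2) * \<gamma> ((T ^^ i) x)))"
          by (simp add: S_def sum_distrib_left exp_sum)
        also have "\<dots> \<le> W x"
          unfolding W_def
        proof (intro prod_mono conjI)
          fix i
          define y where "y = \<gamma> ((T ^^ i) x)"
          have y: "0 \<le> y" "y \<le> 1" using \<gamma>01[OF measurable_space[OF funpow_measurable x]] by (auto simp: y_def)
          have "\<bar>r * y\<bar> \<le> \<bar>r\<bar>" unfolding abs_mult using y by (intro mult_left_le) auto
          hence "exp (r * y - 2 * (r * y)\<^sup>2) \<le> 1 + r * y"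
            using r_half by (intro exp_quadratic_le_one_plus) simp
          \<comment> \<open>Replacing the square by \<open>y\<close> on [0, 1] makes the exponent a
            multiple of \<gamma>, so that the product over the orbit becomes an exponential of
            \<open>S\<close>.\<close>
          moreover have "y * y \<le> y" using y by (intro mult_left_le) auto
          hence "2 * r\<^sup>2 * (y * y) \<le> 2 * r\<^sup>2 * y" by (intro mult_left_mono) auto
          hence "(r - 2 * r\<^sup>2) * y \<le> r * y - 2 * (r * y)\<^sup>2"
            by (simp add: power2_eq_square algebra_simps)
          ultimately show "exp ((r - 2 * r\<^sup>2) * \<gamma> ((T ^^ i) x)) \<le> 1 + r * \<gamma> ((T ^^ i) x)"
            unfolding y_def[symmetric] by (meson exp_le_cancel_iff order_trans)
        qed auto
        finally show ?thesis .
      qed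
      have "prob {x \<in> space M. (r - 2 * r\<^sup>2) * S x \<ge> b} \<le> prob {x \<in> space M. W x \<ge> exp b}"
      proof (rule finite_measure_mono)
        show "{x \<in> space M. exp b \<le> W x} \<in> events"
          using borel_measurable_integrable[OF W(1)] by measurable
        show "{x \<in> space M. (r - 2 * r\<^sup>2) * S x \<ge> b} \<subseteq> {x \<in> space M. W x \<ge> exp b}"
          using W_ge by (auto intro: order_trans[OF iffD2[OF exp_le_cancel_iff]])
      qed
      also have "\<dots> \<le> (\<integral>x. W x \<partial>M) / exp b"
        by (rule integral_Markov_inequality_measure[OF W(1) sets.empty_sets W(2)]) simp
      also have "\<dots> \<le> exp (n * m * (r + D * r\<^sup>2)) / exp b"
        using moment[OF \<gamma> \<gamma>01 r, of n] by (intro divide_right_mono) (auto simp: W_def m_def)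
      finally show ?thesis by (simp add: exp_diff)
    qed
    have nm: "0 \<le> n * m" using m by simp
    have u1: "prob {x \<in> space M. (t - 2 * t\<^sup>2) * S x \<ge> (t - 2 * t\<^sup>2) * ((1 + \<epsilon>) * (n * m))} \<le> exp (- c * (n * m))"
    proof (rule order_trans[OF tail])
      have "t + D * t\<^sup>2 - (t - 2 * t\<^sup>2) * (1 + \<epsilon>) = t\<^sup>2 * E - t * \<epsilon>"
        by (simp add: E_def algebra_simps)
      hence "(n * m) * (t + D * t\<^sup>2 - (t - 2 * t\<^sup>2) * (1 + \<epsilon>)) \<le> (n * m) * (- c)"
        using t2E nm by (intro mult_left_mono) auto
      thus "exp (n * m * (t + D * t\<^sup>2) - (t - 2 * t\<^sup>2) * ((1 + \<epsilon>) * (n * m))) \<le> exp (- c * (n * m))"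
        by (simp add: algebra_simps)
    qed (use t in simp)
    have u2: "{x \<in> space M. S x \<ge> (1 + \<epsilon>) * (n * m)} \<subseteq>
        {x \<in> space M. (t - 2 * t\<^sup>2) * S x \<ge> (t - 2 * t\<^sup>2) * ((1 + \<epsilon>) * (n * m))}"
    proof -
      have "0 \<le> t * (1 - 2 * t)" using t t0 by (intro mult_nonneg_nonneg) auto
      hence "0 \<le> t - 2 * t\<^sup>2" by (simp add: power2_eq_square algebra_simps)
      thus ?thesis by (auto intro: mult_left_mono)
    qed
    have upper: "prob {x \<in> space M. S x \<ge> (1 + \<epsilon>) * (n * m)} \<le> exp (- c * (n * m))"
      by (rule order_trans[OF finite_measure_mono[OF u2] u1]) measurable
    have l1: "prob {x \<in> space M. (- t - 2 * (- t)\<^sup>2) * S x \<ge> (- t - 2 * (- t)\<^sup>2) * ((1 - \<epsilon>) * (n * m))} \<le> exp (- c * (n * m))"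
    proof (rule order_trans[OF tail])
      have "- t + D * (- t)\<^sup>2 - (- t - 2 * (- t)\<^sup>2) * (1 - \<epsilon>) = t\<^sup>2 * E - t * \<epsilon> - 4 * \<epsilon> * t\<^sup>2"
        by (simp add: E_def algebra_simps)
      moreover have "0 \<le> 4 * \<epsilon> * t\<^sup>2" using \<epsilon> by simp
      ultimately have "- t + D * (- t)\<^sup>2 - (- t - 2 * (- t)\<^sup>2) * (1 - \<epsilon>) \<le> - c" using t2E by linarith
      hence "(n * m) * (- t + D * (- t)\<^sup>2 - (- t - 2 * (- t)\<^sup>2) * (1 - \<epsilon>)) \<le> (n * m) * (- c)"
        using nm by (rule mult_left_mono)
      thus "exp (n * m * (- t + D * (- t)\<^sup>2) - (- t - 2 * (- t)\<^sup>2) * ((1 - \<epsilon>) * (n * m))) \<le> exp (- c * (n * m))"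
        by (simp add: algebra_simps)
    qed (use t in simp)
    have l2: "{x \<in> space M. S x \<le> (1 - \<epsilon>) * (n * m)} \<subseteq>
        {x \<in> space M. (- t - 2 * (- t)\<^sup>2) * S x \<ge> (- t - 2 * (- t)\<^sup>2) * ((1 - \<epsilon>) * (n * m))}"
    proof -
      \<comment> \<open>For r = -t the multiplier of \<open>S\<close> is not positive, so small
        values of \<open>S\<close> give large values of the multiple.\<close>
      have "- t - 2 * (- t)\<^sup>2 \<le> 0" using t by (smt (verit) zero_le_power2)
      thus ?thesis by (auto intro: mult_left_mono_neg)
    qed
    have lower: "prob {x \<in> space M. S x \<le> (1 - \<epsilon>) * (n * m)} \<le> exp (- c * (n * m))"
      by (rule order_trans[OF finite_measure_mono[OF l2] l1]) measurable
    have "prob {x \<in> space M. \<bar>S x - n * m\<bar> \<ge> \<epsilon> * (n * m)}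
        \<le> prob ({x \<in> space M. S x \<ge> (1 + \<epsilon>) * (n * m)} \<union> {x \<in> space M. S x \<le> (1 - \<epsilon>) * (n * m)})"
    proof (rule finite_measure_mono)
      have "x \<in> {x. y \<le> \<bar>x - z\<bar>} \<longleftrightarrow> y + z \<le> x \<or> x \<le> z - y" for x y z :: real by auto
      thus "{x \<in> space M. \<bar>S x - n * m\<bar> \<ge> \<epsilon> * (n * m)} \<subseteq>
          {x \<in> space M. S x \<ge> (1 + \<epsilon>) * (n * m)} \<union> {x \<in> space M. S x \<le> (1 - \<epsilon>) * (n * m)}"
        by (auto simp: algebra_simps)
    qed measurable
    also have "\<dots> \<le> prob {x \<in> space M. S x \<ge> (1 + \<epsilon>) * (n * m)} + prob {x \<in> space M. S x \<le> (1 - \<epsilon>) * (n * m)}"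
      by (rule measure_Un_le) measurable
    finally show "prob {x \<in> space M. \<bar>(\<Sum>i<n. \<gamma> ((T ^^ i) x)) - n * (\<integral>x. \<gamma> x \<partial>M)\<bar> \<ge> \<epsilon> * (n * (\<integral>x. \<gamma> x \<partial>M))}
        \<le> 2 * exp (- c * (n * (\<integral>x. \<gamma> x \<partial>M)))"
      using upper lower unfolding S_def[symmetric] m_def[symmetric] by linarith
  qed
qed

section \<open>Truncated sums and the almost sure limit\<close>

lemma (in property_C) integral_comp_funpow:
  fixes g :: "'a \<Rightarrow> real"
  assumes g: "g \<in> borel_measurable M"
  shows "(\<integral>x. g ((T ^^ k) x) \<partial>M) = (\<integral>x. g x \<partial>M)"
proof -
  have "distr M M (T ^^ k) = M"
  proof (induction k)
    case 0
    show ?case by (simp add: distr_id2 id_def)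
  next
    case (Suc k)
    have "distr M M (T ^^ Suc k) = distr (distr M M (T ^^ k)) M T"
      unfolding funpow.simps by (rule distr_distr[OF T_measurable funpow_measurable, symmetric])
    thus ?case unfolding Suc invariant .
  qed
  thus ?thesis using integral_distr[OF funpow_measurable[of k] g] by simp
qed

lemma (in property_C) integrable_comp_funpow:
  fixes g :: "'a \<Rightarrow> real"
  assumes g[measurable]: "g \<in> borel_measurable M" and bound: "\<And>x. x \<in> space M \<Longrightarrow> \<bar>g x\<bar> \<le> B"
  shows "integrable M (\<lambda>x. g ((T ^^ k) x))"
proof (rule integrable_const_bound)
  have [measurable]: "T ^^ k \<in> measurable M M" by (rule funpow_measurable)
  show "(\<lambda>x. g ((T ^^ k) x)) \<in> borel_measurable M" by measurable
  show "AE x in M. norm (g ((T ^^ k) x)) \<le> B"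
    using bound measurable_space[OF funpow_measurable] by (intro AE_I2) auto
qed

lemma (in property_D) trunc_bounds:
  "x \<in> space M \<Longrightarrow> 0 \<le> l \<Longrightarrow> 0 \<le> trunc chi l x \<and> trunc chi l x \<le> l"
  using chi_nonneg[of x] by (auto simp: trunc_def indicator_def)

lemma (in property_D) trunc_measurable: "trunc chi l \<in> borel_measurable M"
  unfolding trunc_def using chi_measurable by measurable

lemma (in property_D) integral_trunc_sum:
  assumes "0 \<le> l"
  shows "(\<integral>x. trunc_sum T chi l n x \<partial>M) = n * (\<integral>x. trunc chi l x \<partial>M)"
  unfolding trunc_sum_def
  using trunc_bounds[OF _ assms] trunc_measurable
  by (subst Bochner_Integration.integral_sum)
     (auto simp: integral_comp_funpow intro!: integrable_comp_funpow[where B = l])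

text \<open>\<open>c\<close> is fixed before \<open>l\<close>, so the level may vary with
  \<open>n\<close>; the bound is later used with \<open>l\<close> equal to
  \<open>f n\<close>.\<close>

lemma (in property_D) trunc_sum_deviation:
  assumes "\<epsilon> > 0"
  obtains c where "c > 0"
    "\<And>l n. l > 0 \<Longrightarrow>
      prob {x \<in> space M. \<bar>trunc_sum T chi l n x - n * (\<integral>x. trunc chi l x \<partial>M)\<bar> \<ge> \<epsilon> * (n * (\<integral>x. trunc chi l x \<partial>M))}
        \<le> 2 * exp (- c * (n * (\<integral>x. trunc chi l x \<partial>M) / l))"
proof -
  obtain K where K: "\<And>l. l > 0 \<Longrightarrow> (\<lambda>x. complex_of_real (trunc chi l x)) \<in> \<F>"
      "\<And>l. l > 0 \<Longrightarrow> nrm (\<lambda>x. complex_of_real (trunc chi l x)) \<le> K * l"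
    using chi_bounds by blast
  obtain c where c: "c > 0" and dev:
    "\<And>\<gamma> n. (\<lambda>x. complex_of_real (\<gamma> x)) \<in> \<F> \<Longrightarrow> nrm (\<lambda>x. complex_of_real (\<gamma> x)) \<le> K \<Longrightarrow>
      (\<And>x. x \<in> space M \<Longrightarrow> 0 \<le> \<gamma> x \<and> \<gamma> x \<le> 1) \<Longrightarrow>
      prob {x \<in> space M. \<bar>(\<Sum>i<n. \<gamma> ((T ^^ i) x)) - n * (\<integral>x. \<gamma> x \<partial>M)\<bar> \<ge> \<epsilon> * (n * (\<integral>x. \<gamma> x \<partial>M))}
        \<le> 2 * exp (- c * (n * (\<integral>x. \<gamma> x \<partial>M)))"
    using orbit_sum_deviation[OF assms, of K] by blast
  show thesis
  proof (rule that[OF c])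
    fix l :: real and n :: nat assume l: "l > 0"
    define \<gamma> where "\<gamma> x = trunc chi l x / l" for x
    define I where "I = (\<integral>x. trunc chi l x \<partial>M)"
    have \<gamma>_eq: "(\<lambda>x. complex_of_real (\<gamma> x)) = (\<lambda>x. of_real (1 / l) * complex_of_real (trunc chi l x))"
      by (simp add: \<gamma>_def)
    have mem: "(\<lambda>x. complex_of_real (\<gamma> x)) \<in> \<F>"
      unfolding \<gamma>_eq by (intro scale_mem K l)
    have nrm: "nrm (\<lambda>x. complex_of_real (\<gamma> x)) \<le> K"
    proof -
      have "nrm (\<lambda>x. complex_of_real (\<gamma> x)) = 1 / l * nrm (\<lambda>x. complex_of_real (trunc chi l x))"
        unfolding \<gamma>_eq nrm_scale[OF K(1)[OF l]] using l by (simp add: norm_divide)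
      also have "\<dots> \<le> 1 / l * (K * l)" using K(2)[OF l] l by (intro mult_left_mono) auto
      finally show ?thesis using l by simp
    qed
    have \<gamma>01: "0 \<le> \<gamma> x \<and> \<gamma> x \<le> 1" if "x \<in> space M" for x
      using trunc_bounds[OF that, of l] l by (auto simp: \<gamma>_def)
    have \<gamma>_int: "(\<integral>x. \<gamma> x \<partial>M) = I / l" by (simp add: \<gamma>_def I_def)
    have sum_eq: "(\<Sum>i<n. \<gamma> ((T ^^ i) x)) = trunc_sum T chi l n x / l" for x
      by (simp add: \<gamma>_def trunc_sum_def sum_divide_distrib)
    have "(\<epsilon> * (n * (I / l)) \<le> \<bar>trunc_sum T chi l n x / l - n * (I / l)\<bar>) \<longleftrightarrow>
        (\<epsilon> * (n * I) \<le> \<bar>trunc_sum T chi l n x - n * I\<bar>)" for x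
    proof -
      have "\<bar>trunc_sum T chi l n x / l - n * (I / l)\<bar> = \<bar>trunc_sum T chi l n x - n * I\<bar> / l"
        using l by (simp add: diff_divide_distrib[symmetric])
      moreover have "\<epsilon> * (n * (I / l)) = (\<epsilon> * (n * I)) / l" by simp
      ultimately show ?thesis using l by (simp only: divide_le_cancel) auto
    qed
    thus "prob {x \<in> space M. \<bar>trunc_sum T chi l n x - n * (\<integral>x. trunc chi l x \<partial>M)\<bar> \<ge> \<epsilon> * (n * (\<integral>x. trunc chi l x \<partial>M))}
        \<le> 2 * exp (- c * (n * (\<integral>x. trunc chi l x \<partial>M) / l))"
      using dev[OF mem nrm \<gamma>01, of n] unfolding sum_eq \<gamma>_int I_def[symmetric] by simp
  qed
qed

theorem theorem2p4:
  fixes M :: "'a measure" and T :: "'a \<Rightarrow> 'a"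
    and \<F> :: "('a \<Rightarrow> complex) set" and nrm :: "('a \<Rightarrow> complex) \<Rightarrow> real"
    and chi :: "'a \<Rightarrow> real" and f \<psi> :: "nat \<Rightarrow> real"
  assumes "property_D M T \<F> nrm chi"
    and "\<And>n. n \<ge> 1 \<Longrightarrow> f n > 0"
    and "\<And>n. n \<ge> 1 \<Longrightarrow> measure M {x \<in> space M. chi x \<le> f n} > 0"
    and "\<psi> \<in> Psi"
    and "eventually (\<lambda>n. (\<integral>x. trunc chi (f n) x \<partial>M) > 0) sequentially"
    and "(\<lambda>n. f n / (\<integral>x. trunc chi (f n) x \<partial>M)) \<in> o(\<lambda>n. real n / ln (\<psi> n))"
  shows "AE x in M. (\<lambda>n. trunc_sum T chi (f n) n x / (\<integral>y. trunc_sum T chi (f n) n y \<partial>M)) \<longlonglongrightarrow> 1"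
proof -
  interpret property_D M T \<F> nrm chi by fact
  define I where "I n = (\<integral>x. trunc chi (f n) x \<partial>M)" for n
  have I_pos: "eventually (\<lambda>n. I n > 0) sequentially" using assms(5) by (simp add: I_def)
  have \<psi>_sum: "summable (\<lambda>n. 1 / \<psi> n)" and \<psi>_pos: "\<And>n. n \<ge> 1 \<Longrightarrow> \<psi> n > 0"
    using assms(4) summable_Suc_iff[of "\<lambda>n. 1 / \<psi> n"] by (auto simp: Psi_def)
  \<comment> \<open>Summability sends 1 / \<psi> to 0, so ln \<psi> is eventually positive and the
    o-condition can be solved for it.\<close>
  have \<psi>_gt1: "eventually (\<lambda>n. \<psi> n > 1) sequentially"
    using order_tendstoD(2)[OF summable_LIMSEQ_zero[OF \<psi>_sum] zero_less_one] eventually_ge_at_top[of 1]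
    by eventually_elim (use \<psi>_pos in \<open>simp add: divide_less_eq\<close>)
  have conv: "AE x in M. eventually (\<lambda>n. \<bar>trunc_sum T chi (f n) n x - n * I n\<bar> < \<epsilon> * (n * I n)) sequentially"
    if \<epsilon>: "\<epsilon> > 0" for \<epsilon> :: real
  proof -
    obtain c where c: "c > 0" and dev: "\<And>l n. l > 0 \<Longrightarrow>
      prob {x \<in> space M. \<bar>trunc_sum T chi l n x - n * (\<integral>x. trunc chi l x \<partial>M)\<bar> \<ge> \<epsilon> * (n * (\<integral>x. trunc chi l x \<partial>M))}
        \<le> 2 * exp (- c * (n * (\<integral>x. trunc chi l x \<partial>M) / l))"
      using trunc_sum_deviation[OF \<epsilon>] by blast
    define A where "A n = {x \<in> space M. \<bar>trunc_sum T chi (f n) n x - n * I n\<bar> \<ge> \<epsilon> * (n * I n)}" for n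
    have [measurable]: "T ^^ i \<in> measurable M M" "trunc chi l \<in> borel_measurable M" for i l
      by (rule funpow_measurable, rule trunc_measurable)
    have A_sets: "A n \<in> sets M" for n unfolding A_def trunc_sum_def by measurable
    \<comment> \<open>The o-condition is taken with the deviation constant \<open>c\<close> itself.
      It then says that ln (\<psi> n) is at most c n I_n / f_n, which is the exponent of the tail
      bound.\<close>
    have ev: "eventually (\<lambda>n. prob (A n) \<le> 2 * (1 / \<psi> n)) sequentially"
      using landau_o.smallD[OF assms(6) c] \<psi>_gt1 I_pos eventually_ge_at_top[of 1]
    proof eventually_elim
      case (elim n)
      have f: "f n > 0" using elim assms(2) by simp
      have "f n / I n \<le> c * (n / ln (\<psi> n))" using elim f by (simp add: I_def)
      hence "ln (\<psi> n) \<le> c * (n * I n / f n)" using elim f by (simp add: field_simps)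
      hence "2 * exp (- c * (n * I n / f n)) \<le> 2 * exp (- ln (\<psi> n))" by simp
      also have "\<dots> = 2 * (1 / \<psi> n)" using elim by (simp add: exp_minus field_simps)
      finally show ?case using dev[OF f, of n] unfolding A_def I_def by linarith
    qed
    have "summable (\<lambda>n. prob (A n))"
      by (rule summable_comparison_test_ev[OF _ summable_mult[OF \<psi>_sum, of 2]])
         (use ev in eventually_elim, simp)
    hence "AE x in M. eventually (\<lambda>n. x \<in> space M - A n) sequentially"
      by (intro borel_cantelli_AE1 A_sets) (simp_all add: less_top[symmetric])
    thus ?thesis
    proof eventually_elim
      case (elim x)
      thus ?case by eventually_elim (auto simp: A_def)
    qed
  qed
  \<comment> \<open>Countably many tolerances 1 / (k + 1) allow a single exceptional null
    set.\<close>
  have "AE x in M. \<forall>k::nat. eventually (\<lambda>n. \<bar>trunc_sum T chi (f n) n x - n * I n\<bar> < 1 / Suc k * (n * I n)) sequentially"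
    by (subst AE_all_countable) (intro allI conv, simp)
  thus ?thesis
  proof eventually_elim
    case (elim x)
    show ?case
    proof (rule tendstoI)
      fix e :: real assume "e > 0"
      then obtain k :: nat where k: "1 / Suc k < e" using nat_approx_posE by metis
      show "eventually (\<lambda>n. dist (trunc_sum T chi (f n) n x / (\<integral>y. trunc_sum T chi (f n) n y \<partial>M)) 1 < e) sequentially"
        using elim[rule_format, of k] I_pos eventually_ge_at_top[of 1]
      proof eventually_elim
        case (elim n)
        define S where "S = trunc_sum T chi (f n) n x"
        have p: "real n * I n > 0" using elim by simp
        have "S / (n * I n) - 1 = (S - n * I n) / (n * I n)"
          using elim(2,3) by (simp add: diff_divide_distrib)
        hence "\<bar>S / (n * I n) - 1\<bar> = \<bar>S - n * I n\<bar> / (n * I n)"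
          using p by (simp only: abs_divide abs_of_pos)
        also have "\<dots> < 1 / Suc k" using elim(1) p by (simp only: S_def[symmetric] pos_divide_less_eq)
        finally have "\<bar>S / (n * I n) - 1\<bar> < e" using k by linarith
        thus ?case
          using integral_trunc_sum[of "f n" n] assms(2)[of n] elim by (simp add: dist_real_def S_def I_def)
      qed
    qed
  qed
qed

end
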